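(* Let $(p_n)_{n\ge 1}$ be a sequence of tearing probabilities in $(0,1)$ such that the limit $\alpha = \lim_{n\to\infty} p_n \log n$ exists. Then the capacity of the torn-paper channel with tearing probabilities $(p_n)$ is $$C = e^{-\alpha}.$$
   Context: Logarithms $\log$ are base 2. The torn-paper channel with block length $n$ and tearing probability $p_n$ is defined as follows. The input is a binary string $X^n=(X_1,\dots,X_n)\in\{0,1\}^n$. Let $T_2,\dots,T_n$ be i.i.d. $\mathrm{Bernoulli}(p_n)$ random variables (independent of the input), $T_i$ indicating a cut between $X_{i-1}$ and $X_i$; equivalently, with $N_1,N_2,\dots$ i.i.d. $\mathrm{Geometric}(p_n)$ (support $\{1,2,\dots\}$, mean $1/p_n$) and $K$ the smallest index with $\sum_{i=1}^K N_i\ge n$, the input is cut into consecutive fragments $\vec X_i = (X_{1+\sum_{j<i}N_j},\dots,X_{\sum_{j\le i}N_j})$ for $i<K$ and $\vec X_K=(X_{1+\sum_{j<K}N_j},\dots,X_n)$. Given $K$, let $\pi$ be a uniformly random permutation of $\{1,\dots,K\}$; the channel output is the unordered collection $\mathcal Y=\{\vec Y_1,\dots,\vec Y_K\}$ with $\vec Y_i=\vec X_{\pi_i}$. A code of rate $R$ consists of $2^{nR}$ binary codewords of length $n$ and a decoder mapping the output collection to an estimate $\hat W\in\{1,\dots,2^{nR}\}$; the message $W$ is uniform on $\{1,\dots,2^{nR}\}$. A rate $R$ is achievable if there is a sequence of rate-$R$ codes with $n\to\infty$ whose error probability $\Pr(\hat W\ne W)$ tends to $0$; the capacity $C$ is the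 supremum of achievable rates. *)

theory Defs
  imports "HOL-Probability.Probability" "HOL-Library.Multiset"
begin

text \<open>Splitting a string into fragments. The input is a list of pairs (symbol, flag),
  where the flag of position i indicates a cut between positions i-1 and i
  (the flag of the first position is ignored).\<close>
fun pieces :: "('a \<times> bool) list \<Rightarrow> 'a list list" where
  "pieces [] = []"
| "pieces [(a, c)] = [[a]]"
| "pieces ((a, c) # (b, d) # rest) =
     (let ps = pieces ((b, d) # rest)
      in if d then [a] # ps else (a # hd ps) # tl ps)"

text \<open>Torn-paper channel with tearing probability q applied to input x:
  cuts T_i (i = 1..length x - 1, cut between x_(i-1) and x_i, 0-based) are i.i.d.
  Bernoulli(q); the output is the unordered collection (multiset) of fragments.\<close>
definition torn_paper :: "real \<Rightarrow> bool list \<Rightarrow> bool list multiset pmf" where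
  "torn_paper q x =
     map_pmf (\<lambda>T. mset (pieces (zip x (map T [0..<length x]))))
       (Pi_pmf {1..<length x} False (\<lambda>_. bernoulli_pmf q))"

definition num_msgs :: "nat \<Rightarrow> real \<Rightarrow> nat" where
  "num_msgs n R = nat \<lceil>2 powr (real n * R)\<rceil>"

definition code_error :: "real \<Rightarrow> nat \<Rightarrow> (nat \<Rightarrow> bool list) \<Rightarrow> (bool list multiset \<Rightarrow> nat) \<Rightarrow> real" where
  "code_error q M enc dec =
     (\<Sum>w<M. measure_pmf.prob (torn_paper q (enc w)) {y. dec y \<noteq> w}) / real M"

definition codes :: "nat \<Rightarrow> nat \<Rightarrow> ((nat \<Rightarrow> bool list) \<times> (bool list multiset \<Rightarrow> nat)) set" where
  "codes n M = {(enc, dec). \<forall>w<M. length (enc w) = n}"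

definition achievable :: "(nat \<Rightarrow> real) \<Rightarrow> real \<Rightarrow> bool" where
  "achievable p R \<longleftrightarrow>
     (\<exists>code :: nat \<Rightarrow> (nat \<Rightarrow> bool list) \<times> (bool list multiset \<Rightarrow> nat).
        (\<forall>n. code n \<in> codes n (num_msgs n R)) \<and>
        (\<lambda>n. code_error (p n) (num_msgs n R) (fst (code n)) (snd (code n))) \<longlonglongrightarrow> 0)"

definition capacity :: "(nat \<Rightarrow> real) \<Rightarrow> real" where
  "capacity p = Sup {R. 0 \<le> R \<and> achievable p R}"

end

theory Submission
  imports Defs
begin

text \<open>
  Let \<open>l\<close> be \<open>log n\<close> rounded up, and let \<open>S\<close> be the sum of \<open>max 0 (length s - l)\<close> over the output
  fragments \<open>s\<close>: locating a fragment among \<open>n\<close> positions costs \<open>l\<close> bits, so \<open>S\<close> measures the information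
  that survives. A fragment of length \<open>L\<close> contains \<open>max 0 (L - l)\<close> windows of \<open>l + 1\<close> consecutive
  positions, hence \<open>S\<close> is the number of windows without a cut. Its mean is
  \<open>(n - l) (1 - p_n)^l \<sim> n exp (- \<alpha>)\<close>, and only windows at distance less than \<open>l\<close> are correlated, so
  \<open>S / n\<close> tends to \<open>exp (- \<alpha>)\<close> in probability by Chebyshev's inequality.

  Achievability: at most \<open>2^(n - S)\<close> words of length \<open>n\<close> contain the fragments of length at least \<open>l\<close>
  at disjoint positions, so a random (or greedily chosen) code of rate below \<open>exp (- \<alpha>)\<close> is decoded by
  looking for a codeword that contains them.

  Converse: for a fixed cut pattern, the number of correctly decoded messages is at most the number
  of outputs. A generating function over multisets of strings shows that only
  \<open>2^((exp (- \<alpha>) + o(1)) n)\<close> outputs have \<open>o(n)\<close> fragments and \<open>S \<le> (exp (- \<alpha>) + o(1)) n\<close>.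
\<close>

subsection \<open>Fragments and uncut windows\<close>

lemma pieces_eq_Nil_iff [simp]: "pieces zs = [] \<longleftrightarrow> zs = []"
  by (induction zs rule: pieces.induct) (auto simp: Let_def)

lemma concat_pieces: "concat (pieces zs) = map fst zs"
proof (induction zs rule: pieces.induct)
  case (3 a c b d rest)
  obtain q ps where "pieces ((b, d) # rest) = q # ps"
    by (cases "pieces ((b, d) # rest)") (use pieces_eq_Nil_iff in blast)+
  with 3 show ?case by (auto simp: Let_def)
qed auto

lemma Nil_notin_pieces: "[] \<notin> set (pieces zs)"
proof (induction zs rule: pieces.induct)
  case (3 a c b d rest)
  then show ?case
    by (auto simp: Let_def dest: list.set_sel(2)[rotated])
qed auto

text \<open>The first fragment runs until the first cut after position 0, whose own flag is ignored.
  In the induction for \<open>excess_pieces\<close> this decides whether the window starting at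
  position 0 is uncut.\<close>

lemma less_length_hd_pieces_iff:
  "zs \<noteq> [] \<Longrightarrow> l < length (hd (pieces zs)) \<longleftrightarrow>
    l < length zs \<and> (\<forall>i\<in>{1..l}. \<not> snd (zs ! i))"
proof (induction zs arbitrary: l rule: pieces.induct)
  case (3 a c b d rest)
  show ?case
  proof (cases l)
    case 0
    then show ?thesis by (simp add: Let_def)
  next
    case (Suc k)
    have *: "(\<forall>i\<in>{1..l}. \<not> snd (((a, c) # (b, d) # rest) ! i)) \<longleftrightarrow>
      \<not> d \<and> (\<forall>i\<in>{1..k}. \<not> snd (((b, d) # rest) ! i))"
    proof -
      have "{1..l} = insert 1 (Suc ` {1..k})" unfolding Suc by (auto simp: image_Suc_atLeastAtMost)
      then show ?thesis by (simp del: image_Suc_atLeastAtMost)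
    qed
    show ?thesis unfolding * using "3.IH"[of k] Suc by (auto simp: Let_def)
  qed
qed auto

text \<open>Prepending a symbol shifts all positions by one, so index 0 is the only possible new
  contribution to a count. The bound \<open>N\<close> provides finiteness.\<close>

lemma card_shifted_indices:
  assumes "\<And>j. P j \<Longrightarrow> j < (N::nat)" "\<And>j. Q (Suc j) \<longleftrightarrow> P j"
  shows "card {j. Q j} = card {j. P j} + of_bool (Q 0)"
proof -
  have fin: "finite {j. P j}" by (rule finite_subset[of _ "{..<N}"]) (use assms in auto)
  have "{j. Q j} = (if Q 0 then {0} else {}) \<union> Suc ` {j. P j}"
    using assms(2) by (auto simp: image_iff) (metis not0_implies_Suc)+
  then show ?thesis using fin by (auto simp: card_insert_if card_image)
qed

text \<open>A fragment of length \<open>L\<close> has \<open>L - l\<close> windows of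
  \<open>l + 1\<close> positions, in truncated subtraction. Prepending a symbol creates or lengthens
  the first fragment, and both sides grow by one exactly when that fragment is now longer than
  \<open>l\<close>.\<close>

lemma excess_pieces:
  "(\<Sum>s\<leftarrow>pieces zs. length s - l) =
    card {j. j + l < length zs \<and> (\<forall>i\<in>{j+1..j+l}. \<not> snd (zs ! i))}"
proof (induction zs rule: pieces.induct)
  case (2 a c)
  have "{j. j + l < length [(a, c)] \<and> (\<forall>i\<in>{j+1..j+l}. \<not> snd ([(a, c)] ! i))} = (if l = 0 then {0} else {})"
    by auto
  then show ?case by auto
next
  case (3 a c b d rest)
  let ?zs = "(b, d) # rest"
  obtain q ps where q: "pieces ?zs = q # ps"
    by (cases "pieces ?zs") (use pieces_eq_Nil_iff in blast)+
  have shift: "(\<forall>i\<in>{Suc j+1..Suc j+l}. \<not> snd (((a, c) # ?zs) ! i)) \<longleftrightarrow>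
      (\<forall>i\<in>{j+1..j+l}. \<not> snd (?zs ! i))" for j
  proof -
    have "{Suc j+1..Suc j+l} = Suc ` {j+1..j+l}" by (simp add: image_Suc_atLeastAtMost)
    then show ?thesis by (simp del: image_Suc_atLeastAtMost)
  qed
  have "card {j. j + l < length ((a, c) # ?zs) \<and> (\<forall>i\<in>{j+1..j+l}. \<not> snd (((a, c) # ?zs) ! i))}
    = card {j. j + l < length ?zs \<and> (\<forall>i\<in>{j+1..j+l}. \<not> snd (?zs ! i))}
      + of_bool (0 + l < length ((a, c) # ?zs) \<and> (\<forall>i\<in>{0+1..0+l}. \<not> snd (((a, c) # ?zs) ! i)))"
    by (rule card_shifted_indices[where N = "length ?zs"]) (simp_all only: shift, auto)
  also have "0 + l < length ((a, c) # ?zs) \<and> (\<forall>i\<in>{0+1..0+l}. \<not> snd (((a, c) # ?zs) ! i))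
    \<longleftrightarrow> l < length (hd (pieces ((a, c) # ?zs)))"
    by (subst less_length_hd_pieces_iff) auto
  also have "card {j. j + l < length ?zs \<and> (\<forall>i\<in>{j+1..j+l}. \<not> snd (?zs ! i))} =
      (\<Sum>s\<leftarrow>pieces ?zs. length s - l)"
    using "3.IH" by simp
  also have "(\<Sum>s\<leftarrow>pieces ?zs. length s - l) + of_bool (l < length (hd (pieces ((a, c) # ?zs))))
    = (\<Sum>s\<leftarrow>pieces ((a, c) # ?zs). length s - l)"
    using q by (auto simp: Let_def)
  finally show ?case by (rule sym)
qed auto

lemma length_pieces_le:
  "length (pieces zs) \<le> 1 + card {i. 1 \<le> i \<and> i < length zs \<and> snd (zs ! i)}"
proof (induction zs rule: pieces.induct)
  case (3 a c b d rest)
  let ?zs = "(b, d) # rest"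
  obtain q ps where q: "pieces ?zs = q # ps"
    by (cases "pieces ?zs") (use pieces_eq_Nil_iff in blast)+
  have *: "card {i. 1 \<le> i \<and> i < length ((a,c) # ?zs) \<and> snd (((a,c) # ?zs) ! i)}
    = card {i. i < length ?zs \<and> snd (?zs ! i)}"
    by (subst card_shifted_indices[where N = "length ?zs" and P = "\<lambda>i. i < length ?zs \<and> snd (?zs ! i)"]) auto
  \<comment> \<open>The flag \<open>d\<close> is at position 0 of the tail, where splitting ignores
    it, but at position 1 of the whole list, where it makes a cut.\<close>
  also have "\<dots> = card {i. 1 \<le> i \<and> i < length ?zs \<and> snd (?zs ! i)} + of_bool d"
  proof -
    have "{i. i < length ?zs \<and> snd (?zs ! i)} = (if d then {0} else {}) \<union> {i. 1 \<le> i \<and> i < length ?zs \<and> snd (?zs ! i)}"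
      by (auto simp: nth_Cons split: nat.splits)
    then show ?thesis by (auto simp: card_insert_if)
  qed
  finally show ?case using "3.IH" q by (auto simp: Let_def)
qed auto

text \<open>The channel output for a fixed cut pattern: all randomness is then in \<open>T\<close>,
  and one pattern can be applied to every codeword.\<close>

definition frags :: "'a list \<Rightarrow> (nat \<Rightarrow> bool) \<Rightarrow> 'a list multiset" where
  "frags x T = mset (pieces (zip x (map T [0..<length x])))"

definition excess :: "nat \<Rightarrow> 'a list multiset \<Rightarrow> nat" where
  "excess l y = (\<Sum>s\<in>#y. length s - l)"

text \<open>The window starting at \<open>j\<close> has \<open>l + 1\<close> positions, with the
  \<open>l\<close> possible cuts \<open>j+1..j+l\<close> between them.\<close>

definition uncut_windows :: "nat \<Rightarrow> nat \<Rightarrow> (nat \<Rightarrow> bool) \<Rightarrow> nat" where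
  "uncut_windows n l T = card {j. j + l < n \<and> (\<forall>i\<in>{j+1..j+l}. \<not> T i)}"

definition num_cuts :: "nat \<Rightarrow> (nat \<Rightarrow> bool) \<Rightarrow> nat" where
  "num_cuts n T = card {i\<in>{1..<n}. T i}"

text \<open>The right side does not involve the symbols of \<open>x\<close>, so concentration of the
  excess can be proved for the cut pattern alone, uniformly over all codes.\<close>

lemma excess_frags: "excess l (frags x T) = uncut_windows (length x) l T"
proof -
  have "excess l (frags x T) = (\<Sum>s\<leftarrow>pieces (zip x (map T [0..<length x])). length s - l)"
    by (simp add: excess_def frags_def flip: mset_map sum_mset_sum_list)
  also have "\<dots> = uncut_windows (length x) l T"
    unfolding excess_pieces uncut_windows_def by (rule arg_cong[where f = card]) auto
  finally show ?thesis .
qed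

lemma size_frags_le: "size (frags x T) \<le> 1 + num_cuts (length x) T"
proof -
  have "{i. 1 \<le> i \<and> i < length (zip x (map T [0..<length x])) \<and> snd (zip x (map T [0..<length x]) ! i)}
     = {i\<in>{1..<length x}. T i}" by auto
  then show ?thesis
    using length_pieces_le[of "zip x (map T [0..<length x])"]
    by (simp only: frags_def num_cuts_def size_mset)
qed

lemma mem_frags:
  assumes "s \<in># frags x T"
  shows "s \<noteq> []" "length s \<le> length x"
proof -
  let ?ps = "pieces (zip x (map T [0..<length x]))"
  have s: "s \<in> set ?ps" using assms by (simp add: frags_def)
  then show "s \<noteq> []" using Nil_notin_pieces by metis
  have "length s \<le> length (concat ?ps)"
    using s by (auto simp: length_concat intro!: member_le_sum_list)
  then show "length s \<le> length x" by (simp add: concat_pieces)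
qed

subsection \<open>Words containing given fragments\<close>

text \<open>A parse of the word from left to right into free letters and fragments. Disjoint
  placement is thus expressed without positions, in a form that yields a recursion for
  counting.\<close>

inductive embeds :: "'a list multiset \<Rightarrow> 'a list \<Rightarrow> bool" where
  embeds_Nil: "embeds {#} []"
| embeds_skip: "embeds y x \<Longrightarrow> embeds y (b # x)"
| embeds_frag: "embeds y x \<Longrightarrow> embeds (add_mset s y) (s @ x)"

lemma embeds_append: "embeds y x \<Longrightarrow> embeds y (s @ x)"
  by (induction s) (auto intro: embeds_skip)

text \<open>Fragments that fail \<open>P\<close> are read as free letters.\<close>

lemma embeds_concat: "embeds (filter_mset P (mset ps)) (concat ps)"
  by (induction ps) (auto intro: embeds.intros embeds_append)

lemma embeds_frags: "embeds (filter_mset P (frags x T)) x"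
  using embeds_concat[of P "pieces (zip x (map T [0..<length x]))"]
  by (simp add: frags_def concat_pieces)

lemma finite_words: "finite {x :: bool list. length x = n}"
  using finite_lists_length_eq[of "UNIV :: bool set" n] by simp

lemma card_words: "card {x :: bool list. length x = n} = 2 ^ n"
  using card_lists_length_eq[of "UNIV :: bool set" n] by simp

text \<open>Scanning from the left, a word either starts with one of the fragments or with a free
  letter, and \<open>(m - 1)^k + k * (m - 1)^(k - 1) \<le> m^k\<close>.\<close>
lemma card_embeds_le:
  assumes "\<forall>s\<in>#y. s \<noteq> []"
  shows "real (card {x :: bool list. length x = m \<and> embeds y x}) * 2 ^ (\<Sum>s\<in>#y. length s)
    \<le> real m ^ size y * 2 ^ m"
  using assms
proof (induction m arbitrary: y rule: less_induct)
  case (less m)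
  let ?A = "\<lambda>y m. {x :: bool list. length x = m \<and> embeds y x}"
  have fin: "finite (?A y m)" for y m
    by (rule finite_subset[OF _ finite_words[of m]]) auto
  show ?case
  proof (cases m)
    case 0
    have "y = {#}" if "embeds y ([] :: bool list)"
      using that less.prems by (cases rule: embeds.cases) auto
    then have *: "?A y m \<subseteq> (if y = {#} then {[]} else {})" using 0 by auto
    show ?thesis
    proof (cases "y = {#}")
      case True
      then have "card (?A y m) \<le> card {[] :: bool list}" using * by (intro card_mono) auto
      then show ?thesis using True 0 by simp
    next
      case False
      then have "?A y m = {}" using * by auto
      then show ?thesis by (simp only: card.empty) simp
    qed
  next
    case (Suc k)
    let ?L = "\<lambda>y. \<Sum>s\<in>#y. length s"
    \<comment> \<open>Words that start with the fragment \<open>s\<close>, followed by a rest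
      containing the other fragments. As \<open>s\<close> is nonempty, the rest has at most
      \<open>k\<close> letters.\<close>
    let ?B = "\<lambda>s. if length s \<le> m then (\<lambda>x. s @ x) ` ?A (y - {#s#}) (m - length s) else {}"
    have "?A y m \<subseteq> (\<Union>b\<in>UNIV. (\<lambda>x. b # x) ` ?A y k) \<union> (\<Union>s\<in>set_mset y. ?B s)"
    proof
      fix x assume "x \<in> ?A y m"
      then have x: "embeds y x" "length x = m" by auto
      from x(1) show "x \<in> (\<Union>b\<in>UNIV. (\<lambda>x. b # x) ` ?A y k) \<union> (\<Union>s\<in>set_mset y. ?B s)"
      proof (cases rule: embeds.cases)
        case embeds_Nil then show ?thesis using x Suc by auto
      next
        case (embeds_skip x' b) then show ?thesis using x Suc by auto
      next
        case (embeds_frag y' x' s)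
        then have "x \<in> ?B s" "s \<in># y" using x by auto
        then show ?thesis by blast
      qed
    qed
    then have "card (?A y m) \<le> card ((\<Union>b\<in>UNIV. (\<lambda>x. b # x) ` ?A y k) \<union> (\<Union>s\<in>set_mset y. ?B s))"
      by (rule card_mono[rotated]) (auto simp: fin)
    also have "\<dots> \<le> card (\<Union>b\<in>UNIV. (\<lambda>x. b # x) ` ?A y k) + card (\<Union>s\<in>set_mset y. ?B s)"
      by (rule card_Un_le)
    also have "card (\<Union>b\<in>UNIV. (\<lambda>x. b # x) ` ?A y k) \<le> (\<Sum>b\<in>(UNIV :: bool set). card ((\<lambda>x. b # x) ` ?A y k))"
      by (rule card_UN_le) auto
    also have "\<dots> \<le> (\<Sum>b\<in>(UNIV :: bool set). card (?A y k))"
      by (intro sum_mono card_image_le fin)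
    also have "\<dots> = 2 * card (?A y k)" by simp
    also have "card (\<Union>s\<in>set_mset y. ?B s) \<le> (\<Sum>s\<in>set_mset y. card (?B s))"
      by (rule card_UN_le) auto
    finally have "card (?A y m) \<le> 2 * card (?A y k) + (\<Sum>s\<in>set_mset y. card (?B s))" by simp
    from of_nat_mono[OF this, where 'a = real]
    have *: "real (card (?A y m)) \<le> 2 * real (card (?A y k)) + (\<Sum>s\<in>set_mset y. real (card (?B s)))"
      unfolding of_nat_add of_nat_mult of_nat_sum by (simp only: of_nat_numeral)
    have IH0: "real (card (?A y k)) * 2 ^ ?L y \<le> real k ^ size y * 2 ^ k"
      using less.IH[of k y] less.prems Suc by auto
    have IH1: "real (card (?B s)) * 2 ^ ?L y \<le> real k ^ (size y - 1) * 2 ^ m" if s: "s \<in># y" for s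
    proof (cases "length s \<le> m")
      case True
      obtain y' where y: "y = add_mset s y'" using s by (metis multi_member_split)
      have sne: "s \<noteq> []" using less.prems s by auto
      have "real (card (?B s)) * 2 ^ ?L y = real (card (?B s)) * 2 ^ ?L y' * 2 ^ length s"
        by (simp add: y power_add)
      also have "\<dots> \<le> real (card (?A y' (m - length s))) * 2 ^ ?L y' * 2 ^ length s"
        using True by (auto intro!: mult_right_mono card_image_le fin simp: y)
      also have "\<dots> \<le> (real (m - length s) ^ size y' * 2 ^ (m - length s)) * 2 ^ length s"
        by (intro mult_right_mono less.IH) (use less.prems sne Suc y in auto)
      also have "\<dots> = real (m - length s) ^ size y' * 2 ^ m"
        using True by (simp flip: power_add)
      also have "\<dots> \<le> real k ^ size y' * 2 ^ m"
        using sne Suc by (intro mult_right_mono power_mono) (cases s, auto)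
      finally show ?thesis by (simp add: y)
    qed auto
    have "real (card (?A y m)) * 2 ^ ?L y \<le>
       2 * (real (card (?A y k)) * 2 ^ ?L y) + (\<Sum>s\<in>set_mset y. real (card (?B s)) * 2 ^ ?L y)"
      using mult_right_mono[OF *, of "2 ^ ?L y"] by (simp add: algebra_simps sum_distrib_left)
    also have "\<dots> \<le> 2 * (real k ^ size y * 2 ^ k) + (\<Sum>s\<in>set_mset y. real k ^ (size y - 1) * 2 ^ m)"
      by (intro add_mono mult_left_mono sum_mono IH0 IH1) auto
    also have "\<dots> = (real k ^ size y + real (card (set_mset y)) * real k ^ (size y - 1)) * 2 ^ m"
      using Suc by (simp add: algebra_simps)
    \<comment> \<open>Equal fragments give the same first choice, so there are at most
      \<open>size y\<close> choices.\<close>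
    also have "\<dots> \<le> (real k ^ size y + real (size y) * real k ^ (size y - 1)) * 2 ^ m"
    proof -
      have "card (set_mset y) \<le> size y" by (induction y) (auto simp: card_insert_if)
      then show ?thesis by (intro mult_right_mono add_left_mono) auto
    qed
    also have "real k ^ size y + real (size y) * real k ^ (size y - 1) \<le> (real k + 1) ^ size y"
    proof (cases "size y")
      case (Suc j)
      have "real (Suc j choose 0) * real k ^ Suc j + real (Suc j choose 1) * real k ^ j \<le> (1 + real k) ^ Suc j"
        unfolding binomial_ring
      proof -
        have "(\<Sum>i\<in>{0,1}. real (Suc j choose i) * 1 ^ i * real k ^ (Suc j - i))
          \<le> (\<Sum>i\<le>Suc j. real (Suc j choose i) * 1 ^ i * real k ^ (Suc j - i))"
          by (rule sum_mono2) auto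
        then show "real (Suc j choose 0) * real k ^ Suc j + real (Suc j choose 1) * real k ^ j
           \<le> (\<Sum>i\<le>Suc j. real (Suc j choose i) * 1 ^ i * real k ^ (Suc j - i))" by simp
      qed
      then show ?thesis using Suc by (simp add: algebra_simps)
    qed auto
    finally show ?thesis using Suc by (simp add: add.commute)
  qed
qed

subsection \<open>Achievability at finite block length\<close>

text \<open>Positions outside \<open>{1..<n}\<close> carry the default \<open>False\<close>, so the
  support is finite and every real function of the pattern is integrable.\<close>

definition cuts_pmf :: "nat \<Rightarrow> real \<Rightarrow> (nat \<Rightarrow> bool) pmf" where
  "cuts_pmf n q = Pi_pmf {1..<n} False (\<lambda>_. bernoulli_pmf q)"

lemma torn_paper_eq: "torn_paper q x = map_pmf (frags x) (cuts_pmf (length x) q)"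
  by (simp add: torn_paper_def cuts_pmf_def frags_def[abs_def])

lemma prob_torn_paper:
  "measure_pmf.prob (torn_paper q x) {y. P y} =
    measure_pmf.prob (cuts_pmf (length x) q) {T. P (frags x T)}"
  by (simp add: torn_paper_eq vimage_def)

lemma finite_set_cuts_pmf: "finite (set_pmf (cuts_pmf n q))"
proof (rule finite_subset)
  show "set_pmf (cuts_pmf n q) \<subseteq> PiE_dflt {1..<n} False (\<lambda>_. UNIV)"
    unfolding cuts_pmf_def by (subst set_Pi_pmf) (auto simp: PiE_dflt_def)
qed (auto intro!: finite_PiE_dflt)

text \<open>The sum is the expected number of indices whose event occurs, so a bound for each fixed
  pattern suffices. It serves both directions: counting confusable words and counting correctly
  decoded messages.\<close>

lemma sum_prob_cuts_le:
  assumes "\<And>T. real (card {i\<in>I. P i T}) \<le> B" and "finite I"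
  shows "(\<Sum>i\<in>I. measure_pmf.prob (cuts_pmf n q) {T. P i T}) \<le> B"
proof -
  let ?D = "cuts_pmf n q"
  have int: "integrable ?D f" for f :: "_ \<Rightarrow> real"
    by (rule integrable_measure_pmf_finite[OF finite_set_cuts_pmf])
  have "(\<Sum>i\<in>I. measure_pmf.prob ?D {T. P i T}) = (\<Sum>i\<in>I. \<integral>T. indicator {T. P i T} T \<partial>?D)"
    by simp
  also have "\<dots> = (\<integral>T. (\<Sum>i\<in>I. indicator {T. P i T} T) \<partial>?D)"
    by (rule Bochner_Integration.integral_sum[symmetric]) (rule int)
  also have "\<dots> = (\<integral>T. real (card {i\<in>I. P i T}) \<partial>?D)"
  proof -
    have "(\<Sum>i\<in>I. indicator {T. P i T} T) = real (card {i\<in>I. P i T})" for T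
      using \<open>finite I\<close> by (simp add: indicator_def Int_def)
    then show ?thesis by simp
  qed
  also have "\<dots> \<le> (\<integral>T. B \<partial>?D)" by (intro integral_mono int assms)
  finally show ?thesis by simp
qed

text \<open>A derandomised random code: codewords are added one at a time, and averaging over
  \<open>X\<close> finds a new word whose total cost against the \<open>m\<close> earlier ones is at
  most \<open>m * e\<close>. Only pairs from an earlier to a later word are charged.\<close>

lemma greedy_selection:
  fixes g :: "'a \<Rightarrow> 'a \<Rightarrow> real"
  assumes X: "finite X" "X \<noteq> {}"
    and avg: "\<And>x. x \<in> X \<Longrightarrow> (\<Sum>x'\<in>X. g x x') \<le> e * real (card X)" and e: "0 \<le> e"
  shows "\<exists>f. (\<forall>w. f w \<in> X) \<and> (\<Sum>w<m. \<Sum>w'\<in>{w<..<m}. g (f w) (f w')) \<le> (real m)\<^sup>2 * e"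
proof (induction m)
  case 0
  show ?case using X by (auto intro!: exI[of _ "\<lambda>_. SOME x. x \<in> X"] simp: some_in_eq)
next
  case (Suc m)
  then obtain f where f: "\<And>w. f w \<in> X" "(\<Sum>w<m. \<Sum>w'\<in>{w<..<m}. g (f w) (f w')) \<le> (real m)\<^sup>2 * e"
    by blast
  have "\<exists>x\<in>X. (\<Sum>w<m. g (f w) x) \<le> real m * e"
  proof (rule ccontr)
    assume "\<not> ?thesis"
    then have "(\<Sum>x\<in>X. real m * e) < (\<Sum>x\<in>X. \<Sum>w<m. g (f w) x)"
      using X by (intro sum_strict_mono) auto
    also have "\<dots> = (\<Sum>w<m. \<Sum>x\<in>X. g (f w) x)" by (rule sum.swap)
    also have "\<dots> \<le> (\<Sum>w<m. e * real (card X))" by (intro sum_mono avg f)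
    finally show False by (simp add: algebra_simps)
  qed
  then obtain x where x: "x \<in> X" "(\<Sum>w<m. g (f w) x) \<le> real m * e" by blast
  let ?f = "f(m := x)"
  have "(\<Sum>w<Suc m. \<Sum>w'\<in>{w<..<Suc m}. g (?f w) (?f w')) =
    (\<Sum>w<m. \<Sum>w'\<in>insert m {w<..<m}. g (?f w) (?f w'))"
  proof -
    have "{m<..<Suc m} = {}" by auto
    moreover have "{w<..<Suc m} = insert m {w<..<m}" if "w < m" for w using that by auto
    ultimately show ?thesis by simp
  qed
  also have "\<dots> = (\<Sum>w<m. g (f w) x) + (\<Sum>w<m. \<Sum>w'\<in>{w<..<m}. g (f w) (f w'))"
    by (simp add: sum.distrib)
  also have "\<dots> \<le> real m * e + (real m)\<^sup>2 * e" using f x by simp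
  also have "\<dots> \<le> (real (Suc m))\<^sup>2 * e"
  proof -
    have "real m + (real m)\<^sup>2 \<le> (real (Suc m))\<^sup>2" by (simp add: power2_eq_square algebra_simps)
    from mult_right_mono[OF this e] show ?thesis by (simp add: algebra_simps)
  qed
  finally show ?case using f x by (intro exI[of _ ?f]) auto
qed

text \<open>Fragments shorter than \<open>l\<close> are dropped, since the \<open>l\<close> bits for
  a position outweigh their length. The transmitted word always passes this test.\<close>

definition frag_compatible :: "nat \<Rightarrow> bool list \<Rightarrow> bool list multiset \<Rightarrow> bool" where
  "frag_compatible l x y \<longleftrightarrow> embeds (filter_mset (\<lambda>s. l \<le> length s) y) x"

text \<open>If \<open>k\<close> fragments are kept, their total length is
  \<open>l * k + excess l y\<close>; the placement factor \<open>n^k\<close> is at most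
  \<open>2^(l * k)\<close> and cancels.\<close>

lemma card_frag_compatible_le:
  assumes "\<forall>s\<in>#y. s \<noteq> []" and nl: "n \<le> 2 ^ l"
  shows "real (card {x. length x = n \<and> frag_compatible l x y}) \<le> 2 ^ n / 2 ^ excess l y"
proof -
  let ?y = "filter_mset (\<lambda>s. l \<le> length s) y"
  have L: "(\<Sum>s\<in>#?y. length s) = l * size ?y + excess l y"
    unfolding excess_def by (induction y) auto
  have "real (card {x. length x = n \<and> frag_compatible l x y}) * 2 ^ (l * size ?y + excess l y) \<le> real n ^ size ?y * 2 ^ n"
    using card_embeds_le[of ?y n] assms unfolding L[symmetric] frag_compatible_def by auto
  also have "real n ^ size ?y \<le> (2 ^ l) ^ size ?y"
    using of_nat_mono[OF nl, where 'a = real] by (intro power_mono) auto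
  finally have "(real (card {x. length x = n \<and> frag_compatible l x y}) * 2 ^ excess l y) * 2 ^ (l * size ?y)
      \<le> 2 ^ n * 2 ^ (l * size ?y)"
    by (simp add: power_add power_mult mult_ac)
  then have "real (card {x. length x = n \<and> frag_compatible l x y}) * 2 ^ excess l y \<le> 2 ^ n"
    by (rule mult_right_le_imp_le) auto
  then show ?thesis by (simp add: field_simps)
qed

text \<open>An error requires either fewer than \<open>b\<close> uncut windows or a wrong codeword
  compatible with the output. With at least \<open>b\<close> uncut windows, a fraction of at most
  \<open>2^(-b)\<close> of all words is compatible, which is the average cost for the greedy
  choice.\<close>

lemma achievability_bound:
  assumes nl: "n \<le> 2 ^ l"
  shows "\<exists>c\<in>codes n M. code_error q M (fst c) (snd c) \<le>
     measure_pmf.prob (cuts_pmf n q) {T. real (uncut_windows n l T) < b} + real M * 2 powr (-b)"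
proof -
  let ?D = "cuts_pmf n q" and ?X = "{x :: bool list. length x = n}"
  let ?good = "\<lambda>T. b \<le> real (uncut_windows n l T)"
  define g where "g x x' = measure_pmf.prob ?D {T. ?good T \<and> frag_compatible l x' (frags x T)}" for x x'
  have "(\<Sum>x'\<in>?X. g x x') \<le> 2 powr (-b) * real (card ?X)" if x: "x \<in> ?X" for x
    unfolding g_def
  proof (rule sum_prob_cuts_le)
    fix T
    show "real (card {x'\<in>?X. ?good T \<and> frag_compatible l x' (frags x T)}) \<le> 2 powr (-b) * real (card ?X)"
    proof (cases "?good T")
      case True
      have "real (card {x'. length x' = n \<and> frag_compatible l x' (frags x T)}) \<le> 2 ^ n / 2 ^ excess l (frags x T)"
        using mem_frags(1)[of _ x T] by (intro card_frag_compatible_le nl) auto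
      also have "\<dots> = 2 ^ n * 2 powr (- real (uncut_windows n l T))"
        using x by (simp add: excess_frags powr_minus powr_realpow divide_inverse)
      also have "\<dots> \<le> 2 ^ n * 2 powr (-b)" using True by simp
      finally show ?thesis using True by (simp add: card_words mult.commute)
    qed (simp add: card_words)
  qed (rule finite_words)
  moreover have "?X \<noteq> {}" using Ex_list_of_length[of n] by auto
  ultimately obtain f where "\<And>w. f w \<in> ?X"
    and sum: "(\<Sum>w<M. \<Sum>w'\<in>{w<..<M}. g (f w) (f w')) \<le> (real M)\<^sup>2 * 2 powr (-b)"
    using greedy_selection[OF finite_words, of n g "2 powr (-b)" M] by auto
  then have f: "length (f w) = n" for w by auto
  \<comment> \<open>Taking the greatest compatible index matters: the sent index \<open>w\<close> is
    compatible, so an error can only lead to some \<open>w' > w\<close>, matching the ordered pairs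
    charged in the greedy selection.\<close>
  define dec where "dec y = (GREATEST w. w < M \<and> frag_compatible l (f w) y)" for y
  have err: "measure_pmf.prob (torn_paper q (f w)) {y. dec y \<noteq> w} \<le>
      measure_pmf.prob ?D {T. real (uncut_windows n l T) < b} + (\<Sum>w'\<in>{w<..<M}. g (f w) (f w'))"
    if w: "w < M" for w
  proof -
    have "{T. dec (frags (f w) T) \<noteq> w} \<subseteq> {T. real (uncut_windows n l T) < b} \<union>
       (\<Union>w'\<in>{w<..<M}. {T. ?good T \<and> frag_compatible l (f w') (frags (f w) T)})"
    proof
      fix T assume T: "T \<in> {T. dec (frags (f w) T) \<noteq> w}"
      have "frag_compatible l (f w) (frags (f w) T)" by (simp add: frag_compatible_def embeds_frags)
      then have *: "dec (frags (f w) T) < M \<and> frag_compatible l (f (dec (frags (f w) T))) (frags (f w) T)"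
        "w \<le> dec (frags (f w) T)"
        using GreatestI_nat[of "\<lambda>w'. w' < M \<and> frag_compatible l (f w') (frags (f w) T)" w M]
          Greatest_le_nat[of "\<lambda>w'. w' < M \<and> frag_compatible l (f w') (frags (f w) T)" w M] w
        unfolding dec_def by auto
      then have "dec (frags (f w) T) \<in> {w<..<M}" using T by auto
      with * show "T \<in> {T. real (uncut_windows n l T) < b} \<union>
         (\<Union>w'\<in>{w<..<M}. {T. ?good T \<and> frag_compatible l (f w') (frags (f w) T)})"
        by (cases "?good T") (intro UnI2 UN_I, auto)
    qed
    then have "measure_pmf.prob ?D {T. dec (frags (f w) T) \<noteq> w} \<le>
       measure_pmf.prob ?D ({T. real (uncut_windows n l T) < b} \<union>
       (\<Union>w'\<in>{w<..<M}. {T. ?good T \<and> frag_compatible l (f w') (frags (f w) T)}))"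
      by (intro measure_pmf.finite_measure_mono) auto
    also have "\<dots> \<le> measure_pmf.prob ?D {T. real (uncut_windows n l T) < b} +
       measure_pmf.prob ?D (\<Union>w'\<in>{w<..<M}. {T. ?good T \<and> frag_compatible l (f w') (frags (f w) T)})"
      by (rule measure_Un_le) auto
    also have "measure_pmf.prob ?D (\<Union>w'\<in>{w<..<M}. {T. ?good T \<and> frag_compatible l (f w') (frags (f w) T)})
       \<le> (\<Sum>w'\<in>{w<..<M}. g (f w) (f w'))"
      unfolding g_def by (rule measure_pmf.finite_measure_subadditive_finite) auto
    finally show ?thesis by (simp add: prob_torn_paper f)
  qed
  have "(\<Sum>w<M. measure_pmf.prob (torn_paper q (f w)) {y. dec y \<noteq> w}) \<le>
     (\<Sum>w<M. measure_pmf.prob ?D {T. real (uncut_windows n l T) < b} + (\<Sum>w'\<in>{w<..<M}. g (f w) (f w')))"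
    by (intro sum_mono err) auto
  also have "\<dots> \<le> real M * measure_pmf.prob ?D {T. real (uncut_windows n l T) < b} + (real M)\<^sup>2 * 2 powr (-b)"
    using sum by (simp add: sum.distrib)
  finally have "code_error q M f dec \<le>
     measure_pmf.prob ?D {T. real (uncut_windows n l T) < b} + real M * 2 powr (-b)"
    by (cases "M = 0") (auto simp: code_error_def field_simps power2_eq_square)
  moreover have "(f, dec) \<in> codes n M" using f by (simp add: codes_def)
  ultimately show ?thesis by force
qed

subsection \<open>Counting typical outputs and the converse at finite block length\<close>

text \<open>The generating function of multisets over \<open>A\<close>: expanding each
  \<open>1 / (1 - w a)\<close> as a geometric series, the product becomes the sum of weights over
  all multisets, and \<open>Y\<close> selects finitely many of these nonnegative terms.\<close>

lemma sum_prod_mset_le: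
  fixes w :: "'a \<Rightarrow> real"
  assumes "finite A" "\<And>a. a \<in> A \<Longrightarrow> 0 \<le> w a" "\<And>a. a \<in> A \<Longrightarrow> w a < 1"
    and "finite Y" "\<And>y. y \<in> Y \<Longrightarrow> set_mset y \<subseteq> A"
  shows "(\<Sum>y\<in>Y. \<Prod>a\<in>#y. w a) \<le> (\<Prod>a\<in>A. 1 / (1 - w a))"
  using assms
proof (induction A arbitrary: Y rule: finite_induct)
  case empty
  then have "Y \<subseteq> {{#}}" by auto
  then have "(\<Sum>y\<in>Y. \<Prod>a\<in>#y. w a) \<le> (\<Sum>y\<in>{{#}}. \<Prod>a\<in>#y. w a)"
    by (intro sum_mono2) auto
  then show ?case by simp
next
  case (insert a A)
  \<comment> \<open>A multiset is determined by the multiplicity of \<open>a\<close> and the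
    remaining multiset; summing over the multiplicity gives the factor of \<open>a\<close>.\<close>
  define h where "h y = (count y a, filter_mset (\<lambda>b. b \<noteq> a) y)" for y
  define Y' where "Y' = snd ` h ` Y"
  have split: "y = filter_mset (\<lambda>b. b \<noteq> a) y + replicate_mset (count y a) a" for y
    by (rule multiset_eqI) auto
  have inj: "inj_on h Y"
    by (rule inj_onI) (metis split h_def prod.inject)
  have Y': "finite Y'" "\<And>y. y \<in> Y' \<Longrightarrow> set_mset y \<subseteq> A"
    using insert.prems(3) insert.prems(4) by (auto simp: Y'_def h_def) blast
  obtain N where N: "fst ` h ` Y \<subseteq> {..<N}"
    using finite_nat_iff_bounded[of "fst ` h ` Y"] insert.prems(3) by auto
  have hY: "h ` Y \<subseteq> {..<N} \<times> Y'"
  proof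
    fix z assume z: "z \<in> h ` Y"
    then have "fst z \<in> {..<N}" "snd z \<in> Y'" using N unfolding Y'_def by blast+
    then show "z \<in> {..<N} \<times> Y'" by (simp add: mem_Times_iff)
  qed
  have wa: "0 \<le> w a" "w a < 1" using insert.prems by auto
  have nonneg: "0 \<le> (\<Prod>b\<in>#y. w b)" if "set_mset y \<subseteq> insert a A" for y
    using that insert.prems(1) by (induction y) auto
  have "(\<Sum>y\<in>Y. \<Prod>b\<in>#y. w b) = (\<Sum>y\<in>Y. (\<lambda>(k, y). w a ^ k * (\<Prod>b\<in>#y. w b)) (h y))"
  proof (rule sum.cong)
    fix y
    have "(\<Prod>b\<in>#y. w b) = (\<Prod>b\<in>#filter_mset (\<lambda>b. b \<noteq> a) y + replicate_mset (count y a) a. w b)"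
      using split[of y] by (rule arg_cong)
    then show "(\<Prod>b\<in>#y. w b) = (\<lambda>(k, y). w a ^ k * (\<Prod>b\<in>#y. w b)) (h y)"
      by (simp add: h_def mult.commute)
  qed simp
  also have "\<dots> = (\<Sum>(k, y)\<in>h ` Y. w a ^ k * (\<Prod>b\<in>#y. w b))"
    by (simp add: sum.reindex[OF inj])
  also have "\<dots> \<le> (\<Sum>(k, y)\<in>{..<N} \<times> Y'. w a ^ k * (\<Prod>b\<in>#y. w b))"
    by (intro sum_mono2 hY) (use Y' wa nonneg in \<open>auto intro!: mult_nonneg_nonneg\<close>, blast)
  also have "\<dots> = (\<Sum>k<N. w a ^ k) * (\<Sum>y\<in>Y'. \<Prod>b\<in>#y. w b)"
    by (simp add: sum_product sum.cartesian_product)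
  also have "\<dots> \<le> 1 / (1 - w a) * (\<Prod>a\<in>A. 1 / (1 - w a))"
  proof (rule mult_mono)
    have "(\<Sum>k<N. w a ^ k) = (1 - w a ^ N) / (1 - w a)"
      using wa by (simp add: sum_gp_strict)
    also have "\<dots> \<le> 1 / (1 - w a)" using wa by (intro divide_right_mono) auto
    finally show "(\<Sum>k<N. w a ^ k) \<le> 1 / (1 - w a)" .
    show "(\<Sum>y\<in>Y'. \<Prod>b\<in>#y. w b) \<le> (\<Prod>a\<in>A. 1 / (1 - w a))"
      by (rule insert.IH) (use insert.prems Y' in auto)
    show "0 \<le> (\<Sum>y\<in>Y'. \<Prod>b\<in>#y. w b)"
      using Y' by (intro sum_nonneg nonneg) auto
  qed (use wa in auto)
  also have "\<dots> = (\<Prod>a\<in>insert a A. 1 / (1 - w a))" using insert.hyps by simp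
  finally show ?case .
qed

lemma sum_bool_lists_length:
  fixes f :: "nat \<Rightarrow> real"
  shows "(\<Sum>s\<in>{s :: bool list. length s \<le> n}. f (length s)) = (\<Sum>L\<le>n. 2 ^ L * f L)"
proof -
  have fin: "finite {s :: bool list. length s \<le> n}"
    using finite_lists_length_le[of "UNIV :: bool set" n] by simp
  have "(\<Sum>s\<in>{s :: bool list. length s \<le> n}. f (length s)) =
      (\<Sum>L\<le>n. \<Sum>s\<in>{s \<in> {s :: bool list. length s \<le> n}. length s = L}. f (length s))"
    by (rule sum.group[symmetric]) (use fin in auto)
  also have "\<dots> = (\<Sum>L\<le>n. 2 ^ L * f L)"
  proof (rule sum.cong)
    fix L assume "L \<in> {..n}"
    then have "{s \<in> {s :: bool list. length s \<le> n}. length s = L} = {s. length s = L}" by auto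
    then show "(\<Sum>s\<in>{s \<in> {s :: bool list. length s \<le> n}. length s = L}. f (length s)) = 2 ^ L * f L"
      by (simp add: card_words)
  qed simp
  finally show ?thesis .
qed

text \<open>With suitable thresholds, outputs fall into this set with high probability, whatever the
  codeword. The bounds on lengths and size make it finite.\<close>

definition typical_outputs :: "nat \<Rightarrow> nat \<Rightarrow> real \<Rightarrow> real \<Rightarrow> bool list multiset set" where
  "typical_outputs n l a b =
    {y. (\<forall>s\<in>#y. length s \<le> n) \<and> real (size y) \<le> a \<and> real (excess l y) \<le> b}"

lemma finite_typical_outputs: "finite (typical_outputs n l a b)"
proof (rule finite_subset)
  let ?A = "{s :: bool list. length s \<le> n}"
  show "typical_outputs n l a b \<subseteq> mset ` {ss. set ss \<subseteq> ?A \<and> length ss \<le> nat \<lfloor>a\<rfloor>}"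
  proof
    fix y assume y: "y \<in> typical_outputs n l a b"
    obtain ss where ss: "mset ss = y" using ex_mset by blast
    have "set ss \<subseteq> ?A" "length ss \<le> nat \<lfloor>a\<rfloor>"
      using y unfolding typical_outputs_def ss[symmetric] by (auto simp: le_nat_floor)
    then show "y \<in> mset ` {ss. set ss \<subseteq> ?A \<and> length ss \<le> nat \<lfloor>a\<rfloor>}" using ss by auto
  qed
  have "finite ?A" using finite_lists_length_le[of "UNIV :: bool set" n] by simp
  then show "finite (mset ` {ss. set ss \<subseteq> ?A \<and> length ss \<le> nat \<lfloor>a\<rfloor>})"
    by (intro finite_imageI finite_lists_length_le)
qed

text \<open>Give a fragment \<open>s\<close> the weight \<open>\<theta> * r^(length s - l)\<close>. The total weight of all
  multisets is a product over fragments, while each typical output weighs at least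
  \<open>\<theta>^a * r^b\<close>.\<close>
lemma card_typical_outputs_le:
  assumes \<theta>: "0 < \<theta>" "\<theta> \<le> 1 / 2" and r: "0 < r" "r < 1 / 2"
  shows "real (card (typical_outputs n l a b)) * (\<theta> powr a * r powr b)
    \<le> exp (2 * \<theta> * 2 ^ l * (1 + 1 / (1 - 2 * r)))"
proof -
  let ?A = "{s :: bool list. length s \<le> n}"
  define w where "w s = \<theta> * r ^ (length s - l)" for s :: "bool list"
  have fin: "finite ?A" using finite_lists_length_le[of "UNIV :: bool set" n] by simp
  have w: "0 \<le> w s" "w s \<le> 1 / 2" for s
  proof -
    have "r ^ (length s - l) \<le> 1" using r by (intro power_le_one) auto
    then have "\<theta> * r ^ (length s - l) \<le> \<theta> * 1" using \<theta> by (intro mult_left_mono) auto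
    then show "w s \<le> 1 / 2" using \<theta> unfolding w_def by linarith
    show "0 \<le> w s" using \<theta> r by (simp add: w_def)
  qed
  \<comment> \<open>This turns the product over all fragments into the exponential of twice their
    total weight.\<close>
  have inv_le: "1 / (1 - u) \<le> exp (2 * u)" if "0 \<le> u" "u \<le> 1 / 2" for u :: real
  proof -
    have "1 \<le> (1 + 2 * u) * (1 - u)" using mult_nonneg_nonneg[of u "1 - 2 * u"] that by (simp add: algebra_simps)
    then have "1 / (1 - u) \<le> 1 + 2 * u" using that by (simp add: field_simps)
    also have "\<dots> \<le> exp (2 * u)" by (rule exp_ge_add_one_self)
    finally show ?thesis .
  qed
  have sum_w: "(\<Sum>s\<in>?A. w s) \<le> \<theta> * 2 ^ l * (1 + 1 / (1 - 2 * r))"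
  proof -
    let ?h = "\<lambda>L. 2 ^ L * r ^ (L - l)"
    \<comment> \<open>Below \<open>l\<close> the terms are \<open>2^L\<close>, with sum
      \<open>2^l - 1\<close>; from \<open>l\<close> on they are \<open>2^l\<close> times a geometric
      series of ratio \<open>2 * r < 1\<close>.\<close>
    have "(\<Sum>L\<le>n. ?h L) \<le> (\<Sum>L\<in>{..<l} \<union> (\<lambda>m. l + m) ` {..n}. ?h L)"
    proof (rule sum_mono2)
      show "{..n} \<subseteq> {..<l} \<union> (\<lambda>m. l + m) ` {..n}"
      proof
        fix L assume "L \<in> {..n}"
        then show "L \<in> {..<l} \<union> (\<lambda>m. l + m) ` {..n}"
          by (cases "L < l") (auto intro!: image_eqI[of _ _ "L - l"])
      qed
    qed (use r in auto)
    also have "\<dots> = (\<Sum>L<l. ?h L) + (\<Sum>L\<in>(\<lambda>m. l + m) ` {..n}. ?h L)"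
      by (rule sum.union_disjoint) auto
    also have "(\<Sum>L<l. ?h L) = 2 ^ l - 1" by (simp add: sum_gp_strict)
    also have "(\<Sum>L\<in>(\<lambda>m. l + m) ` {..n}. ?h L) = 2 ^ l * (\<Sum>m\<le>n. (2 * r) ^ m)"
      by (simp add: sum.reindex power_add sum_distrib_left power_mult_distrib mult_ac)
    also have "(\<Sum>m\<le>n. (2 * r) ^ m) \<le> 1 / (1 - 2 * r)"
    proof -
      have "(\<Sum>m\<le>n. (2 * r) ^ m) = (1 - (2 * r) ^ Suc n) / (1 - 2 * r)"
        using r sum_gp0[of "2 * r" n] by (simp only:) auto
      also have "\<dots> \<le> 1 / (1 - 2 * r)" using r by (intro divide_right_mono) auto
      finally show ?thesis .
    qed
    finally have "(\<Sum>L\<le>n. ?h L) \<le> 2 ^ l * (1 + 1 / (1 - 2 * r))" by (simp add: algebra_simps)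
    then have "\<theta> * (\<Sum>L\<le>n. ?h L) \<le> \<theta> * (2 ^ l * (1 + 1 / (1 - 2 * r)))"
      using \<theta> by (intro mult_left_mono) auto
    moreover have "(\<Sum>s\<in>?A. w s) = \<theta> * (\<Sum>L\<le>n. ?h L)"
      using sum_bool_lists_length[of "\<lambda>L. \<theta> * r ^ (L - l)" n]
      by (simp add: w_def sum_distrib_left mult_ac)
    ultimately show ?thesis by (simp add: mult_ac)
  qed
  have prod_w: "(\<Prod>s\<in>#y. w s) = \<theta> ^ size y * r ^ excess l y" for y
    by (induction y) (auto simp: excess_def w_def power_add)
  have "real (card (typical_outputs n l a b)) * (\<theta> powr a * r powr b) =
      (\<Sum>y\<in>typical_outputs n l a b. \<theta> powr a * r powr b)" by simp
  also have "\<dots> \<le> (\<Sum>y\<in>typical_outputs n l a b. \<Prod>s\<in>#y. w s)"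
  proof (rule sum_mono)
    fix y assume y: "y \<in> typical_outputs n l a b"
    \<comment> \<open>Both bases are below 1, so the upper bounds on size and excess bound the
      weight from below.\<close>
    have "\<theta> powr a \<le> \<theta> powr real (size y)" "r powr b \<le> r powr real (excess l y)"
      using y \<theta> r by (auto intro!: powr_mono' simp: typical_outputs_def)
    then have "\<theta> powr a * r powr b \<le> \<theta> powr real (size y) * r powr real (excess l y)"
      by (intro mult_mono) auto
    then show "\<theta> powr a * r powr b \<le> (\<Prod>s\<in>#y. w s)"
      using \<theta> r by (simp add: prod_w powr_realpow)
  qed
  also have "\<dots> \<le> (\<Prod>s\<in>?A. 1 / (1 - w s))"
  proof (rule sum_prod_mset_le[OF fin])
    show "w s < 1" for s using w(2)[of s] by linarith
  qed (use w finite_typical_outputs in \<open>auto simp: typical_outputs_def\<close>)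
  also have "\<dots> \<le> (\<Prod>s\<in>?A. exp (2 * w s))"
  proof (rule prod_mono, rule conjI)
    fix s :: "bool list"
    show "1 / (1 - w s) \<le> exp (2 * w s)" by (rule inv_le[OF w])
    show "0 \<le> 1 / (1 - w s)" using w(2)[of s] by simp
  qed
  also have "\<dots> = exp (2 * (\<Sum>s\<in>?A. w s))" by (simp add: exp_sum[OF fin] sum_distrib_left)
  also have "\<dots> \<le> exp (2 * \<theta> * 2 ^ l * (1 + 1 / (1 - 2 * r)))" using sum_w by simp
  finally show ?thesis .
qed

text \<open>For a fixed pattern, \<open>dec\<close> inverts the map from correctly decoded messages
  to outputs, so there are no more such messages than typical outputs unless the pattern is bad. The
  threshold \<open>a + 1\<close> arises because fragments exceed cuts by at most one.\<close>

lemma converse_bound: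
  assumes c: "c \<in> codes n M" and M: "0 < M"
  shows "1 - code_error q M (fst c) (snd c) \<le>
     measure_pmf.prob (cuts_pmf n q) {T. real (num_cuts n T) > a \<or> real (uncut_windows n l T) > b}
     + real (card (typical_outputs n l (a + 1) b)) / real M"
proof -
  obtain f dec where c_eq: "c = (f, dec)" by fastforce
  have f: "length (f w) = n" if "w < M" for w using c that by (auto simp: codes_def c_eq)
  let ?D = "cuts_pmf n q"
  let ?bad = "\<lambda>T. real (num_cuts n T) > a \<or> real (uncut_windows n l T) > b"
  let ?p = "measure_pmf.prob ?D {T. ?bad T}"
  have "(\<Sum>w<M. measure_pmf.prob ?D {T. \<not> ?bad T \<and> dec (frags (f w) T) = w})
      \<le> real (card (typical_outputs n l (a + 1) b))"
  proof (rule sum_prob_cuts_le)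
    fix T
    let ?W = "{w \<in> {..<M}. \<not> ?bad T \<and> dec (frags (f w) T) = w}"
    have "card ?W \<le> card (typical_outputs n l (a + 1) b)"
    proof (rule card_inj_on_le[OF _ _ finite_typical_outputs])
      show "inj_on (\<lambda>w. frags (f w) T) ?W" by (rule inj_on_inverseI[where g = dec]) auto
      show "(\<lambda>w. frags (f w) T) ` ?W \<subseteq> typical_outputs n l (a + 1) b"
      proof (clarsimp simp: typical_outputs_def not_less)
        fix w assume w: "w < M" "real (num_cuts n T) \<le> a" "real (uncut_windows n l T) \<le> b"
        then show "(\<forall>s\<in>#frags (f w) T. length s \<le> n) \<and> real (size (frags (f w) T)) \<le> a + 1 \<and>
            real (excess l (frags (f w) T)) \<le> b"
          using size_frags_le[of "f w" T] mem_frags(2)[of _ "f w" T] f[of w]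
          by (auto simp: excess_frags)
      qed
    qed
    then show "real (card ?W) \<le> real (card (typical_outputs n l (a + 1) b))" by simp
  qed simp
  moreover have "1 - measure_pmf.prob (torn_paper q (f w)) {y. dec y \<noteq> w} \<le>
      ?p + measure_pmf.prob ?D {T. \<not> ?bad T \<and> dec (frags (f w) T) = w}" if w: "w < M" for w
  proof -
    have "1 - measure_pmf.prob (torn_paper q (f w)) {y. dec y \<noteq> w} = measure_pmf.prob ?D {T. dec (frags (f w) T) = w}"
      using measure_pmf.prob_compl[of "{T. dec (frags (f w) T) \<noteq> w}" ?D]
      by (simp add: prob_torn_paper f[OF w] Compl_eq_Diff_UNIV[symmetric] Collect_neg_eq[symmetric])
    also have "\<dots> \<le> measure_pmf.prob ?D ({T. ?bad T} \<union> {T. \<not> ?bad T \<and> dec (frags (f w) T) = w})"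
      by (intro measure_pmf.finite_measure_mono) auto
    also have "\<dots> \<le> ?p + measure_pmf.prob ?D {T. \<not> ?bad T \<and> dec (frags (f w) T) = w}"
      by (rule measure_Un_le) auto
    finally show ?thesis .
  qed
  then have "(\<Sum>w<M. 1 - measure_pmf.prob (torn_paper q (f w)) {y. dec y \<noteq> w}) \<le>
      (\<Sum>w<M. ?p + measure_pmf.prob ?D {T. \<not> ?bad T \<and> dec (frags (f w) T) = w})"
    by (intro sum_mono) auto
  ultimately have "real M - (\<Sum>w<M. measure_pmf.prob (torn_paper q (f w)) {y. dec y \<noteq> w}) \<le>
      real M * ?p + real (card (typical_outputs n l (a + 1) b))"
    by (simp add: sum.distrib sum_subtractf)
  then have "(real M - (\<Sum>w<M. measure_pmf.prob (torn_paper q (f w)) {y. dec y \<noteq> w})) / real M \<le>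
      (real M * ?p + real (card (typical_outputs n l (a + 1) b))) / real M"
    by (intro divide_right_mono) auto
  then show ?thesis using M by (simp add: code_error_def c_eq add_divide_distrib diff_divide_distrib)
qed

subsection \<open>Concentration\<close>

lemma prob_no_cuts:
  assumes "A \<subseteq> {1..<n}" "0 \<le> q" "q \<le> 1"
  shows "measure_pmf.prob (cuts_pmf n q) {T. \<forall>i\<in>A. \<not> T i} = (1 - q) ^ card A"
proof -
  let ?B = "\<lambda>i. if i \<in> A then {False} else UNIV"
  have "{T. \<forall>i\<in>A. \<not> T i} = Pi {1..<n} ?B"
    using assms(1) by (auto simp: Pi_def split: if_splits)
  then have "measure_pmf.prob (cuts_pmf n q) {T. \<forall>i\<in>A. \<not> T i} =
      (\<Prod>i\<in>{1..<n}. measure_pmf.prob (bernoulli_pmf q) (?B i))"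
    by (simp only: cuts_pmf_def measure_Pi_pmf_Pi finite_atLeastLessThan)
  also have "\<dots> = (\<Prod>i\<in>{1..<n}. if i \<in> A then 1 - q else 1)"
    using assms by (intro prod.cong) (auto simp: measure_pmf_single)
  also have "\<dots> = (1 - q) ^ card A"
    using assms(1) by (simp add: prod.If_cases Int_absorb1)
  finally show ?thesis .
qed

lemma integrable_cuts_pmf: "integrable (cuts_pmf n q) (f :: _ \<Rightarrow> real)"
  by (rule integrable_measure_pmf_finite[OF finite_set_cuts_pmf])

text \<open>Applied to the number of cuts, and to a squared deviation for Chebyshev's
  inequality.\<close>

lemma cuts_pmf_Markov:
  assumes "0 < t" "\<And>T. 0 \<le> f T" "\<And>T. P T \<Longrightarrow> t \<le> f T"
  shows "measure_pmf.prob (cuts_pmf n q) {T. P T} \<le> measure_pmf.expectation (cuts_pmf n q) f / t"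
proof -
  let ?D = "cuts_pmf n q"
  have "measure_pmf.prob ?D {T. P T} = (\<integral>T. indicator {T. P T} T \<partial>?D)" by simp
  also have "\<dots> \<le> (\<integral>T. f T / t \<partial>?D)"
    using assms by (intro integral_mono integrable_cuts_pmf) (auto simp: indicator_def)
  finally show ?thesis by simp
qed

lemma prob_num_cuts_le:
  assumes "0 \<le> q" "q \<le> 1" "0 < t"
  shows "measure_pmf.prob (cuts_pmf n q) {T. real (num_cuts n T) > t} \<le> real n * q / t"
proof -
  let ?D = "cuts_pmf n q"
  have "measure_pmf.prob ?D {T. T i} = q" if "i \<in> {1..<n}" for i
    using prob_no_cuts[of "{i}" n q] measure_pmf.prob_compl[of "{T. T i}" ?D] that assms
    by (simp add: Compl_eq_Diff_UNIV[symmetric] Collect_neg_eq[symmetric])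
  then have "(\<Sum>i\<in>{1..<n}. measure_pmf.prob ?D {T. T i}) = real (n - 1) * q" by simp
  moreover have "measure_pmf.expectation ?D (\<lambda>T. real (num_cuts n T)) =
     (\<Sum>i\<in>{1..<n}. measure_pmf.prob ?D {T. T i})"
  proof -
    have "real (num_cuts n T) = (\<Sum>i\<in>{1..<n}. indicator {T. T i} T)" for T
      by (simp add: num_cuts_def indicator_def Int_def)
    then have "measure_pmf.expectation ?D (\<lambda>T. real (num_cuts n T)) =
      (\<Sum>i\<in>{1..<n}. measure_pmf.expectation ?D (indicator {T. T i}))"
      by (simp only: Bochner_Integration.integral_sum[OF integrable_cuts_pmf])
    then show ?thesis by simp
  qed
  ultimately have "measure_pmf.expectation ?D (\<lambda>T. real (num_cuts n T)) \<le> real n * q"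
    using assms by (auto intro!: mult_right_mono)
  moreover have "measure_pmf.prob ?D {T. real (num_cuts n T) > t} \<le>
      measure_pmf.expectation ?D (\<lambda>T. real (num_cuts n T)) / t"
    by (rule cuts_pmf_Markov) (use assms in auto)
  ultimately show ?thesis using assms by (smt (verit) divide_right_mono)
qed

text \<open>Windows whose starting points are at least \<open>l\<close> apart are independent.\<close>
lemma second_moment_uncut_windows:
  assumes q: "0 \<le> q" "q \<le> 1"
  shows "measure_pmf.expectation (cuts_pmf n q)
      (\<lambda>T. (real (uncut_windows n l T) - real (n - l) * (1 - q) ^ l)\<^sup>2) \<le> real n * real (2 * l)"
proof -
  let ?D = "cuts_pmf n q" and ?m = "n - l"
  define \<mu> where "\<mu> = (1 - q) ^ l"
  define W where "W j = {j+1..j+l}" for j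
  define X :: "nat \<Rightarrow> (nat \<Rightarrow> bool) \<Rightarrow> real" where "X j = indicator {T. \<forall>i\<in>W j. \<not> T i}" for j
  have S: "real (uncut_windows n l T) - real ?m * \<mu> = (\<Sum>j<?m. X j T - \<mu>)" for T
  proof -
    have "{j. j + l < n \<and> (\<forall>i\<in>{j+1..j+l}. \<not> T i)} = {j \<in> {..<?m}. \<forall>i\<in>W j. \<not> T i}"
      by (auto simp: W_def)
    then have "real (uncut_windows n l T) = (\<Sum>j<?m. X j T)"
      by (simp add: uncut_windows_def X_def indicator_def Int_def)
    then show ?thesis by (simp add: sum_subtractf)
  qed
  have W: "W j \<subseteq> {1..<n}" if "j < ?m" for j using that by (auto simp: W_def)
  have EX: "measure_pmf.expectation ?D (X j) = \<mu>" if "j < ?m" for j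
    using prob_no_cuts[OF W[OF that] q] by (simp add: X_def W_def \<mu>_def)
  have EXX: "measure_pmf.expectation ?D (\<lambda>T. X i T * X j T) = (1 - q) ^ card (W i \<union> W j)"
    if "i < ?m" "j < ?m" for i j
  proof -
    have "(\<lambda>T. X i T * X j T) = indicator {T. \<forall>k\<in>W i \<union> W j. \<not> T k}"
      by (auto simp: X_def indicator_def fun_eq_iff)
    then show ?thesis using prob_no_cuts[of "W i \<union> W j" n q] W that q by auto
  qed
  have cov: "measure_pmf.expectation ?D (\<lambda>T. (X i T - \<mu>) * (X j T - \<mu>)) \<le> of_bool (i < j + l \<and> j < i + l)"
    if "i < ?m" "j < ?m" for i j
  proof -
    have "(\<lambda>T. (X i T - \<mu>) * (X j T - \<mu>)) = (\<lambda>T. X i T * X j T - (\<mu> * X i T + \<mu> * X j T - \<mu>\<^sup>2))"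
      by (simp add: algebra_simps power2_eq_square fun_eq_iff)
    then have "measure_pmf.expectation ?D (\<lambda>T. (X i T - \<mu>) * (X j T - \<mu>)) =
        measure_pmf.expectation ?D (\<lambda>T. X i T * X j T)
          - (\<mu> * measure_pmf.expectation ?D (X i) + \<mu> * measure_pmf.expectation ?D (X j) - \<mu>\<^sup>2)"
      by (simp add: integrable_cuts_pmf)
    also have "\<dots> = (1 - q) ^ card (W i \<union> W j) - \<mu>\<^sup>2"
      using that by (simp add: EX EXX power2_eq_square)
    \<comment> \<open>The condition says that the starting points differ by less than
      \<open>l\<close>. Otherwise \<open>W i\<close> and \<open>W j\<close> are disjoint and the
      covariance vanishes; close pairs get the trivial bound 1.\<close>
    also have "\<dots> \<le> of_bool (i < j + l \<and> j < i + l)"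
    proof (cases "i < j + l \<and> j < i + l")
      case True
      have "(1 - q) ^ card (W i \<union> W j) \<le> 1" using q by (intro power_le_one) auto
      then have "(1 - q) ^ card (W i \<union> W j) - \<mu>\<^sup>2 \<le> 1" using zero_le_power2[of \<mu>] by linarith
      then show ?thesis using True by simp
    next
      case False
      then have "card (W i \<union> W j) = l + l"
        by (subst card_Un_disjoint) (auto simp: W_def)
      then show ?thesis using False by (auto simp: \<mu>_def power_add power2_eq_square)
    qed
    finally show ?thesis .
  qed
  have "measure_pmf.expectation ?D (\<lambda>T. (real (uncut_windows n l T) - real ?m * \<mu>)\<^sup>2) =
     (\<Sum>i<?m. \<Sum>j<?m. measure_pmf.expectation ?D (\<lambda>T. (X i T - \<mu>) * (X j T - \<mu>)))"
    by (simp only: S power2_eq_square sum_product Bochner_Integration.integral_sum[OF integrable_cuts_pmf])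
  also have "\<dots> \<le> (\<Sum>i<?m. \<Sum>j<?m. of_bool (i < j + l \<and> j < i + l))"
    by (intro sum_mono cov) auto
  \<comment> \<open>Fewer than \<open>l\<close> starting points on either side of \<open>i\<close>,
    and \<open>i\<close> itself, are close to \<open>i\<close>.\<close>
  also have "\<dots> \<le> (\<Sum>i<?m. real (2 * l))"
  proof (rule sum_mono)
    fix i
    have "(\<Sum>j<?m. of_bool (i < j + l \<and> j < i + l)) = real (card {j \<in> {..<?m}. i < j + l \<and> j < i + l})"
      by (simp add: Int_def)
    also have "card {j \<in> {..<?m}. i < j + l \<and> j < i + l} \<le> card {i + 1 - l..<i + l}"
      by (intro card_mono) auto
    also have "\<dots> \<le> 2 * l" by auto
    finally show "(\<Sum>j<?m. of_bool (i < j + l \<and> j < i + l)) \<le> real (2 * l)" by simp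
  qed
  also have "\<dots> \<le> real n * real (2 * l)" by (simp add: mult_right_mono)
  finally show ?thesis by (simp add: \<mu>_def)
qed

lemma prob_uncut_windows_deviation:
  assumes "0 \<le> q" "q \<le> 1" "0 < t"
  shows "measure_pmf.prob (cuts_pmf n q) {T. \<bar>real (uncut_windows n l T) - real (n - l) * (1 - q) ^ l\<bar> \<ge> t}
     \<le> real n * real (2 * l) / t\<^sup>2"
proof -
  have "measure_pmf.prob (cuts_pmf n q) {T. \<bar>real (uncut_windows n l T) - real (n - l) * (1 - q) ^ l\<bar> \<ge> t}
     \<le> measure_pmf.expectation (cuts_pmf n q)
      (\<lambda>T. (real (uncut_windows n l T) - real (n - l) * (1 - q) ^ l)\<^sup>2) / t\<^sup>2"
    by (rule cuts_pmf_Markov) (use assms in \<open>auto simp: abs_le_square_iff[symmetric]\<close>)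
  also have "\<dots> \<le> real n * real (2 * l) / t\<^sup>2"
    by (intro divide_right_mono second_moment_uncut_windows assms) auto
  finally show ?thesis .
qed

subsection \<open>Asymptotics\<close>

text \<open>For \<open>n \<ge> 1\<close>, rounding up puts \<open>2^log_len n\<close> between
  \<open>n\<close> and \<open>2 * n\<close>: the lower bound pays for fragment positions in the
  achievability part, the upper one controls the total weight in the converse.\<close>

definition log_len :: "nat \<Rightarrow> nat" where
  "log_len n = nat \<lceil>log 2 (real n)\<rceil>"

lemma log_len_bounds:
  assumes "1 \<le> n"
  shows "log 2 (real n) \<le> real (log_len n)" "real (log_len n) \<le> log 2 (real n) + 1"
proof -
  have "0 \<le> log 2 (real n)" using assms by simp
  then have "real (log_len n) = of_int \<lceil>log 2 (real n)\<rceil>" by (simp add: log_len_def)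
  then show "log 2 (real n) \<le> real (log_len n)" "real (log_len n) \<le> log 2 (real n) + 1"
    using le_of_int_ceiling[of "log 2 (real n)"] of_int_ceiling_le_add_one[of "log 2 (real n)"] by simp_all
qed

lemma le_two_power_log_len: "n \<le> 2 ^ log_len n"
proof (cases "n = 0")
  case False
  then have "real n = 2 powr (log 2 (real n))" by simp
  also have "\<dots> \<le> 2 powr (real (log_len n))"
    using log_len_bounds(1)[of n] False by (intro powr_mono) auto
  also have "\<dots> = real (2 ^ log_len n)" by (simp add: powr_realpow)
  finally show ?thesis by (simp only: of_nat_le_iff)
qed simp

lemma two_power_log_len_le:
  assumes "1 \<le> n" shows "2 ^ log_len n \<le> 2 * real n"
proof -
  have "2 ^ log_len n = 2 powr (real (log_len n))" by (simp add: powr_realpow)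
  also have "\<dots> \<le> 2 powr (log 2 (real n) + 1)" using log_len_bounds(2)[OF assms] by (intro powr_mono) auto
  also have "\<dots> = 2 * real n" using assms by (simp add: powr_add)
  finally show ?thesis .
qed

lemma log_len_over_n: "(\<lambda>n. real (log_len n) / real n) \<longlonglongrightarrow> 0"
proof (rule tendsto_sandwich[where f = "\<lambda>_. 0"])
  show "\<forall>\<^sub>F n in sequentially. real (log_len n) / real n \<le> (ln (real n) / real n) / ln 2 + 1 / real n"
    using eventually_ge_at_top[of 1]
  proof eventually_elim
    case (elim n)
    have "real (log_len n) / real n \<le> (log 2 (real n) + 1) / real n"
      using log_len_bounds(2)[OF elim] by (intro divide_right_mono) auto
    then show ?case by (simp add: log_def add_divide_distrib divide_divide_eq_left mult.commute)
  qed
  show "(\<lambda>n. (ln (real n) / real n) / ln 2 + 1 / real n) \<longlonglongrightarrow> 0"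
    using tendsto_add[OF tendsto_divide[OF lim_ln_over_n tendsto_const[of "ln 2"]] lim_1_over_n] by simp
qed auto

section \<open>Limits of the cut and window statistics\<close>

locale torn_paper_asymptotics =
  fixes p :: "nat \<Rightarrow> real" and \<alpha> :: real
  assumes p: "\<And>n. n \<ge> 1 \<Longrightarrow> 0 < p n \<and> p n < 1"
    and p_log: "(\<lambda>n. p n * log 2 (real n)) \<longlonglongrightarrow> \<alpha>"
begin

text \<open>The product \<open>p n * log 2 n\<close> has a finite limit while its second factor
  diverges.\<close>

lemma p_tendsto_0: "p \<longlonglongrightarrow> 0"
proof -
  have "(\<lambda>n. inverse (ln (real n))) \<longlonglongrightarrow> 0"
    by (intro tendsto_inverse_0_at_top filterlim_compose[OF ln_at_top filterlim_real_sequentially])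
  from tendsto_mult[OF tendsto_const[of "ln 2"] this]
  have "(\<lambda>n. inverse (log 2 (real n))) \<longlonglongrightarrow> 0" by (simp add: log_def divide_inverse mult.commute)
  from tendsto_mult[OF p_log this]
  have "(\<lambda>n. p n * log 2 (real n) * inverse (log 2 (real n))) \<longlonglongrightarrow> 0" by simp
  moreover have "\<forall>\<^sub>F n in sequentially. p n * log 2 (real n) * inverse (log 2 (real n)) = p n"
    using eventually_ge_at_top[of 2]
  proof eventually_elim
    case (elim n)
    then have "0 < log 2 (real n)" by simp
    then have "log 2 (real n) \<noteq> 0" by linarith
    then show ?case by (simp add: mult.assoc)
  qed
  ultimately show ?thesis by (rule Lim_transform_eventually)
qed

text \<open>Rounding the logarithm up changes the product by at most \<open>p n\<close>, which
  vanishes.\<close>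

lemma p_log_len: "(\<lambda>n. p n * real (log_len n)) \<longlonglongrightarrow> \<alpha>"
proof (rule tendsto_sandwich[OF _ _ p_log])
  show "\<forall>\<^sub>F n in sequentially. p n * log 2 (real n) \<le> p n * real (log_len n)"
    using eventually_ge_at_top[of 1]
    by eventually_elim (use p log_len_bounds(1) in \<open>auto intro!: mult_left_mono less_imp_le\<close>)
  show "\<forall>\<^sub>F n in sequentially. p n * real (log_len n) \<le> p n * log 2 (real n) + p n"
    using eventually_ge_at_top[of 1]
  proof eventually_elim
    case (elim n)
    have "p n * real (log_len n) \<le> p n * (log 2 (real n) + 1)"
      using p[OF elim] log_len_bounds(2)[OF elim] by (intro mult_left_mono) auto
    then show ?case by (simp add: algebra_simps)
  qed
  show "(\<lambda>n. p n * log 2 (real n) + p n) \<longlonglongrightarrow> \<alpha>"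
    using tendsto_add[OF p_log p_tendsto_0] by simp
qed

text \<open>By \<open>- p - 2 * p^2 \<le> ln (1 - p) \<le> - p\<close> for small \<open>p\<close>,
  the logarithm differs from \<open>- p n * log_len n\<close> by a multiple of
  \<open>p n * (p n * log_len n)\<close>, which tends to 0.\<close>

lemma prob_window_uncut_tendsto: "(\<lambda>n. (1 - p n) ^ log_len n) \<longlonglongrightarrow> exp (- \<alpha>)"
proof -
  have ev: "\<forall>\<^sub>F n in sequentially. p n < 1 / 2"
    using order_tendstoD(2)[OF p_tendsto_0, of "1 / 2"] by simp
  have "(\<lambda>n. real (log_len n) * ln (1 - p n)) \<longlonglongrightarrow> - \<alpha>"
  proof (rule tendsto_sandwich)
    show "\<forall>\<^sub>F n in sequentially. - (p n * real (log_len n)) - 2 * (p n * real (log_len n)) * p n \<le> real (log_len n) * ln (1 - p n)"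
      using ev eventually_ge_at_top[of 1]
    proof eventually_elim
      case (elim n)
      have "real (log_len n) * (- p n - 2 * (p n)\<^sup>2) \<le> real (log_len n) * ln (1 - p n)"
        using ln_one_minus_pos_lower_bound[of "p n"] p[of n] elim by (intro mult_left_mono) auto
      then show ?case by (simp add: algebra_simps power2_eq_square)
    qed
    show "\<forall>\<^sub>F n in sequentially. real (log_len n) * ln (1 - p n) \<le> - (p n * real (log_len n))"
      using eventually_ge_at_top[of 1]
    proof eventually_elim
      case (elim n)
      have "real (log_len n) * ln (1 - p n) \<le> real (log_len n) * (- p n)"
        using ln_one_minus_pos_upper_bound[of "p n"] p[of n] elim by (intro mult_left_mono) auto
      then show ?case by (simp add: algebra_simps)
    qed
    show "(\<lambda>n. - (p n * real (log_len n)) - 2 * (p n * real (log_len n)) * p n) \<longlonglongrightarrow> - \<alpha>"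
      by (rule tendsto_eq_intros p_log_len p_tendsto_0 refl)+ simp
    show "(\<lambda>n. - (p n * real (log_len n))) \<longlonglongrightarrow> - \<alpha>"
      by (intro tendsto_minus p_log_len)
  qed
  then have "(\<lambda>n. exp (real (log_len n) * ln (1 - p n))) \<longlonglongrightarrow> exp (- \<alpha>)"
    by (rule tendsto_exp)
  moreover have "\<forall>\<^sub>F n in sequentially. exp (real (log_len n) * ln (1 - p n)) = (1 - p n) ^ log_len n"
    using eventually_ge_at_top[of 1]
  proof eventually_elim
    case (elim n)
    then show ?case using p[of n] by (simp add: exp_of_nat_mult)
  qed
  ultimately show ?thesis by (rule Lim_transform_eventually)
qed

lemma mean_uncut_windows_tendsto:
  "(\<lambda>n. real (n - log_len n) * (1 - p n) ^ log_len n / real n) \<longlonglongrightarrow> exp (- \<alpha>)"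
proof -
  have "(\<lambda>n. (1 - real (log_len n) / real n) * (1 - p n) ^ log_len n) \<longlonglongrightarrow> exp (- \<alpha>)"
    by (rule tendsto_eq_intros log_len_over_n prob_window_uncut_tendsto refl)+ simp
  \<comment> \<open>Once \<open>log_len n \<le> n\<close>, the truncated subtraction agrees with the
    real one.\<close>
  moreover have "\<forall>\<^sub>F n in sequentially. (1 - real (log_len n) / real n) * (1 - p n) ^ log_len n =
      real (n - log_len n) * (1 - p n) ^ log_len n / real n"
    using order_tendstoD(2)[OF log_len_over_n, of 1, simplified] eventually_ge_at_top[of 1]
  proof eventually_elim
    case (elim n)
    then have "log_len n \<le> n" by (simp add: field_simps)
    then show ?case using elim by (simp add: of_nat_diff field_simps)
  qed
  ultimately show ?thesis by (rule Lim_transform_eventually)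
qed

text \<open>Half of \<open>\<delta> * n\<close> covers the distance of the mean from its limit, the
  other half the fluctuation around the mean. Chebyshev's inequality then leaves a multiple of
  \<open>log_len n / n\<close>.\<close>

lemma uncut_windows_concentration:
  assumes "0 < \<delta>"
  shows "(\<lambda>n. measure_pmf.prob (cuts_pmf n (p n))
     {T. \<bar>real (uncut_windows n (log_len n) T) - exp (- \<alpha>) * real n\<bar> \<ge> \<delta> * real n}) \<longlonglongrightarrow> 0"
proof (rule tendsto_sandwich[where f = "\<lambda>_. 0"])
  let ?S = "\<lambda>n T. real (uncut_windows n (log_len n) T)"
  let ?mean = "\<lambda>n. real (n - log_len n) * (1 - p n) ^ log_len n"
  have "\<forall>\<^sub>F n in sequentially. dist (?mean n / real n) (exp (- \<alpha>)) < \<delta> / 2"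
    using tendstoD[OF mean_uncut_windows_tendsto, of "\<delta> / 2"] assms by simp
  then show "\<forall>\<^sub>F n in sequentially. measure_pmf.prob (cuts_pmf n (p n))
     {T. \<bar>?S n T - exp (- \<alpha>) * real n\<bar> \<ge> \<delta> * real n} \<le> 8 / \<delta>\<^sup>2 * (real (log_len n) / real n)"
    using eventually_ge_at_top[of 1]
  proof eventually_elim
    case (elim n)
    have n: "0 < real n" using elim by simp
    have "\<bar>?mean n / real n - exp (- \<alpha>)\<bar> * real n < \<delta> / 2 * real n"
      using elim n by (intro mult_strict_right_mono) (auto simp: dist_real_def)
    then have close: "\<bar>?mean n - exp (- \<alpha>) * real n\<bar> < \<delta> / 2 * real n"
      using n by (simp add: abs_mult_pos left_diff_distrib)
    have "measure_pmf.prob (cuts_pmf n (p n)) {T. \<bar>?S n T - exp (- \<alpha>) * real n\<bar> \<ge> \<delta> * real n} \<le>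
      measure_pmf.prob (cuts_pmf n (p n)) {T. \<bar>?S n T - ?mean n\<bar> \<ge> \<delta> / 2 * real n}"
    proof (rule measure_pmf.finite_measure_mono)
      show "{T. \<bar>?S n T - exp (- \<alpha>) * real n\<bar> \<ge> \<delta> * real n} \<subseteq> {T. \<bar>?S n T - ?mean n\<bar> \<ge> \<delta> / 2 * real n}"
      proof
        fix T assume "T \<in> {T. \<bar>?S n T - exp (- \<alpha>) * real n\<bar> \<ge> \<delta> * real n}"
        moreover have "\<delta> * real n = \<delta> / 2 * real n + \<delta> / 2 * real n" by simp
        ultimately show "T \<in> {T. \<bar>?S n T - ?mean n\<bar> \<ge> \<delta> / 2 * real n}"
          using close unfolding mem_Collect_eq by linarith
      qed
    qed simp
    also have "\<dots> \<le> real n * real (2 * log_len n) / (\<delta> / 2 * real n)\<^sup>2"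
      using p[OF elim(2)] assms n by (intro prob_uncut_windows_deviation) auto
    also have "\<dots> = 8 / \<delta>\<^sup>2 * (real (log_len n) / real n)"
      using n assms by (simp add: field_simps power2_eq_square)
    finally show ?case .
  qed
  show "(\<lambda>n. 8 / \<delta>\<^sup>2 * (real (log_len n) / real n)) \<longlonglongrightarrow> 0"
    using tendsto_mult[OF tendsto_const[of "8 / \<delta>\<^sup>2"] log_len_over_n] by simp
qed auto

lemma num_cuts_sublinear:
  assumes "0 < \<delta>"
  shows "(\<lambda>n. measure_pmf.prob (cuts_pmf n (p n)) {T. real (num_cuts n T) > \<delta> * real n}) \<longlonglongrightarrow> 0"
proof (rule tendsto_sandwich[where f = "\<lambda>_. 0"])
  show "\<forall>\<^sub>F n in sequentially.
      measure_pmf.prob (cuts_pmf n (p n)) {T. real (num_cuts n T) > \<delta> * real n} \<le> p n / \<delta>"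
    using eventually_ge_at_top[of 1]
  proof eventually_elim
    case (elim n)
    have "measure_pmf.prob (cuts_pmf n (p n)) {T. real (num_cuts n T) > \<delta> * real n} \<le> real n * p n / (\<delta> * real n)"
      using p[OF elim] elim assms by (intro prob_num_cuts_le) auto
    then show ?case using elim by simp
  qed
  show "(\<lambda>n. p n / \<delta>) \<longlonglongrightarrow> 0" using tendsto_divide[OF p_tendsto_0 tendsto_const[of \<delta>]] assms by simp
qed auto

section \<open>Direct part and converse\<close>

lemma achievable_below:
  assumes R: "0 \<le> R" "R < exp (- \<alpha>)"
  shows "achievable p R"
proof -
  \<comment> \<open>The threshold \<open>b n\<close> lies halfway between \<open>R * n\<close> and
    \<open>exp (- \<alpha>) * n\<close>, leaving a margin \<open>\<delta> * n\<close> for the union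
    bound and the same for the concentration.\<close>
  define \<delta> where "\<delta> = (exp (- \<alpha>) - R) / 2"
  have \<delta>: "0 < \<delta>" using R by (simp add: \<delta>_def)
  define b where "b n = (R + \<delta>) * real n" for n
  let ?err = "\<lambda>n c. code_error (p n) (num_msgs n R) (fst c) (snd c)"
  let ?low = "\<lambda>n. measure_pmf.prob (cuts_pmf n (p n)) {T. real (uncut_windows n (log_len n) T) < b n}"
  let ?dev = "\<lambda>n. measure_pmf.prob (cuts_pmf n (p n))
     {T. \<bar>real (uncut_windows n (log_len n) T) - exp (- \<alpha>) * real n\<bar> \<ge> \<delta> * real n}"
  have "\<forall>n. \<exists>c. c \<in> codes n (num_msgs n R) \<and>
      ?err n c \<le> ?low n + real (num_msgs n R) * 2 powr (- b n)"
    using achievability_bound[OF le_two_power_log_len] by blast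
  then obtain code where code: "\<And>n. code n \<in> codes n (num_msgs n R)"
    "\<And>n. ?err n (code n) \<le> ?low n + real (num_msgs n R) * 2 powr (- b n)" by metis
  have "(\<lambda>n. ?err n (code n)) \<longlonglongrightarrow> 0"
  proof (rule tendsto_sandwich[where f = "\<lambda>_. 0"])
    show "\<forall>\<^sub>F n in sequentially. 0 \<le> ?err n (code n)"
      by (auto simp: code_error_def intro!: always_eventually divide_nonneg_nonneg sum_nonneg)
    show "\<forall>\<^sub>F n in sequentially. ?err n (code n) \<le> ?dev n + 2 * (2 powr (- \<delta>)) ^ n"
    proof (rule always_eventually, rule allI)
      fix n
      have "b n = exp (- \<alpha>) * real n - \<delta> * real n" by (simp add: b_def \<delta>_def field_simps)
      then have "?low n \<le> ?dev n"
        by (intro measure_pmf.finite_measure_mono) auto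
      moreover have "real (num_msgs n R) * 2 powr (- b n) \<le> 2 * (2 powr (- \<delta>)) ^ n"
      proof -
        \<comment> \<open>Since \<open>2^(n R)\<close> is at least 1, rounding the number of
          messages up costs at most a factor 2.\<close>
        have "1 \<le> 2 powr (real n * R)" using R by (simp add: ge_one_powr_ge_zero)
        moreover have "real (num_msgs n R) \<le> 2 powr (real n * R) + 1"
          unfolding num_msgs_def by (simp add: of_nat_nat)
        ultimately have "real (num_msgs n R) \<le> 2 * 2 powr (real n * R)" by linarith
        then have "real (num_msgs n R) * 2 powr (- b n) \<le> 2 * 2 powr (real n * R) * 2 powr (- b n)"
          by (intro mult_right_mono) auto
        also have "\<dots> = 2 * 2 powr (- \<delta> * real n)"
          by (simp add: b_def algebra_simps flip: powr_add)
        also have "2 powr (- \<delta> * real n) = (2 powr (- \<delta>)) ^ n"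
          using powr_powr[of 2 "- \<delta>" "real n"] powr_realpow[of "2 powr (- \<delta>)" n] by simp
        finally show ?thesis .
      qed
      ultimately show "?err n (code n) \<le> ?dev n + 2 * (2 powr (- \<delta>)) ^ n"
        using code(2)[of n] by linarith
    qed
    have "2 powr (- \<delta>) < 2 powr 0" using \<delta> by (intro powr_less_mono) auto
    then have "(\<lambda>n. (2 powr (- \<delta>)) ^ n) \<longlonglongrightarrow> 0" by (intro LIMSEQ_realpow_zero) auto
    from tendsto_add[OF uncut_windows_concentration[OF \<delta>] tendsto_mult[OF tendsto_const[of 2] this]]
    show "(\<lambda>n. ?dev n + 2 * (2 powr (- \<delta>)) ^ n) \<longlonglongrightarrow> 0" by simp
  qed auto
  then show ?thesis using code(1) unfolding achievable_def by blast
qed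

text \<open>A rate exceeding \<open>c = exp (- \<alpha>)\<close> by \<open>\<Delta>\<close> leaves
  an exponential gap between messages and typical outputs. Three quarters of the gap absorb the
  losses in the counting bound, so the success probability would tend to 0.\<close>

lemma achievable_le:
  assumes "achievable p R"
  shows "R \<le> exp (- \<alpha>)"
proof (rule ccontr)
  assume R: "\<not> R \<le> exp (- \<alpha>)"
  define c where "c = exp (- \<alpha>)"
  define \<Delta> where "\<Delta> = R - c"
  have \<Delta>: "0 < \<Delta>" and c: "0 < c" using R by (auto simp: \<Delta>_def c_def)
  \<comment> \<open>With \<open>\<delta> \<le> 1\<close>, replacing base \<open>1 / 2\<close> by
    \<open>r = 2^(- (1 + \<epsilon>))\<close> costs at most \<open>\<Delta> / 4\<close> per letter;
    \<open>r < 1 / 2\<close> keeps the geometric series convergent.\<close>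
  define \<epsilon> where "\<epsilon> = \<Delta> / (4 * (c + 1))"
  have \<epsilon>: "0 < \<epsilon>" "\<epsilon> * (c + 1) = \<Delta> / 4"
    using \<Delta> c by (simp_all add: \<epsilon>_def divide_simps)
  define r :: real where "r = 2 powr (- (1 + \<epsilon>))"
  have r: "0 < r" "r < 1 / 2"
  proof -
    have "r < 2 powr (- 1)" unfolding r_def using \<epsilon> by (intro powr_less_mono) auto
    then show "r < 1 / 2" by (simp add: powr_minus)
  qed (simp add: r_def)
  have ln_r: "ln r = - (1 + \<epsilon>) * ln 2" unfolding r_def by (simp only: ln_powr)
  define C where "C = 1 + 1 / (1 - 2 * r)"
  have C: "0 < C" using r by (simp add: C_def add_pos_pos)
  \<comment> \<open>Small enough for the exponent \<open>4 * \<theta> * C * n\<close>, obtained from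
    \<open>2 * \<theta> * 2^l * C\<close> by \<open>2^l \<le> 2 * n\<close>, to use a quarter of the
    gap.\<close>
  define \<theta> where "\<theta> = min (1 / 2) (ln 2 * \<Delta> / (16 * C))"
  have \<theta>: "0 < \<theta>" "\<theta> \<le> 1 / 2" "4 * \<theta> * C \<le> ln 2 * \<Delta> / 4"
  proof -
    show "0 < \<theta>" "\<theta> \<le> 1 / 2" using \<Delta> C by (auto simp: \<theta>_def)
    have "\<theta> * C \<le> ln 2 * \<Delta> / (16 * C) * C" using C by (intro mult_right_mono) (auto simp: \<theta>_def)
    then show "4 * \<theta> * C \<le> ln 2 * \<Delta> / 4" using C by simp
  qed
  have ln\<theta>: "ln \<theta> < 0" using \<theta> by simp
  \<comment> \<open>The fragment weights cost \<open>- \<delta> * ln \<theta>\<close> and the window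
    deviation costs \<open>\<delta> * ln 2\<close>; together they get another quarter.\<close>
  define \<delta> where "\<delta> = min 1 (ln 2 * \<Delta> / 4 / (ln 2 - ln \<theta>))"
  have den: "0 < ln 2 - ln \<theta>" using ln\<theta> ln_gt_zero[of "2::real"] by linarith
  have \<delta>: "0 < \<delta>" "\<delta> \<le> 1" "\<delta> * (ln 2 - ln \<theta>) \<le> ln 2 * \<Delta> / 4"
  proof -
    show "0 < \<delta>" "\<delta> \<le> 1" using \<Delta> den by (auto simp: \<delta>_def)
    have "\<delta> \<le> ln 2 * \<Delta> / 4 / (ln 2 - ln \<theta>)" unfolding \<delta>_def by (rule min.cobounded2)
    then show "\<delta> * (ln 2 - ln \<theta>) \<le> ln 2 * \<Delta> / 4" using den by (simp only: pos_le_divide_eq)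
  qed
  \<comment> \<open>The exponential rate, in natural logarithms per letter, of the bound on typical
    outputs divided by the number of messages. It is at most
    \<open>- ln 2 * \<Delta> / 4\<close>.\<close>
  define E where "E = 4 * \<theta> * C - \<delta> * ln \<theta> + ln 2 * ((1 + \<epsilon>) * (c + \<delta>) - R)"
  have E: "E < 0"
  proof -
    have "\<epsilon> * (c + \<delta>) \<le> \<epsilon> * (c + 1)" using \<epsilon> \<delta> by (intro mult_left_mono) auto
    then have "(1 + \<epsilon>) * (c + \<delta>) - R \<le> \<delta> - 3 / 4 * \<Delta>"
      using \<epsilon>(2) \<Delta>_def unfolding distrib_right mult_1 by linarith
    then have "ln 2 * ((1 + \<epsilon>) * (c + \<delta>) - R) \<le> ln 2 * (\<delta> - 3 / 4 * \<Delta>)"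
      by (intro mult_left_mono) auto
    then have "E \<le> ln 2 * \<Delta> / 4 + ln 2 * \<Delta> / 4 - 3 / 4 * (ln 2 * \<Delta>)"
      using \<theta>(3) \<delta>(3) unfolding E_def by (simp add: algebra_simps)
    moreover have "0 < ln 2 * \<Delta>" using \<Delta> by simp
    ultimately show ?thesis by linarith
  qed
  obtain code where code: "\<And>n. code n \<in> codes n (num_msgs n R)"
    and err: "(\<lambda>n. code_error (p n) (num_msgs n R) (fst (code n)) (snd (code n))) \<longlonglongrightarrow> 0"
    using assms unfolding achievable_def by blast
  let ?err = "\<lambda>n. code_error (p n) (num_msgs n R) (fst (code n)) (snd (code n))"
  let ?cuts = "\<lambda>n. measure_pmf.prob (cuts_pmf n (p n)) {T. real (num_cuts n T) > \<delta> * real n}"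
  let ?dev = "\<lambda>n. measure_pmf.prob (cuts_pmf n (p n))
     {T. \<bar>real (uncut_windows n (log_len n) T) - exp (- \<alpha>) * real n\<bar> \<ge> \<delta> * real n}"
  have bound: "1 - ?err n \<le> ?cuts n + ?dev n + 1 / \<theta> * exp E ^ n" if n: "1 \<le> n" for n
  proof -
    let ?M = "num_msgs n R" and ?l = "log_len n"
    \<comment> \<open>The summand 1 allows for one more fragment than cuts and results in the
      constant factor \<open>1 / \<theta>\<close>.\<close>
    let ?Y = "typical_outputs n ?l (\<delta> * real n + 1) ((c + \<delta>) * real n)"
    have M: "2 powr (real n * R) \<le> real ?M" unfolding num_msgs_def by linarith
    then have M0: "0 < ?M" by (smt (verit) of_nat_0_less_iff powr_gt_zero)
    have "measure_pmf.prob (cuts_pmf n (p n)) {T. real (num_cuts n T) > \<delta> * real n \<or>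
          real (uncut_windows n ?l T) > (c + \<delta>) * real n}
       \<le> measure_pmf.prob (cuts_pmf n (p n)) ({T. real (num_cuts n T) > \<delta> * real n} \<union>
     {T. \<bar>real (uncut_windows n (log_len n) T) - exp (- \<alpha>) * real n\<bar> \<ge> \<delta> * real n})"
      by (intro measure_pmf.finite_measure_mono) (auto simp: c_def algebra_simps)
    also have "\<dots> \<le> ?cuts n + ?dev n" by (rule measure_Un_le) auto
    finally have "1 - ?err n \<le> ?cuts n + ?dev n + real (card ?Y) / real ?M"
      using converse_bound[OF code M0, where q = "p n" and a = "\<delta> * real n" and l = ?l and b = "(c + \<delta>) * real n"] by linarith
    also have "real (card ?Y) / real ?M \<le> 1 / \<theta> * exp E ^ n"
    proof -
      have "real (card ?Y) * (\<theta> powr (\<delta> * real n + 1) * r powr ((c + \<delta>) * real n))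
          \<le> exp (2 * \<theta> * 2 ^ ?l * C)"
        unfolding C_def using \<theta> r by (intro card_typical_outputs_le) auto
      also have "\<dots> \<le> exp (4 * \<theta> * C * real n)"
      proof -
        have "(2 * \<theta> * C) * 2 ^ ?l \<le> (2 * \<theta> * C) * (2 * real n)"
          using two_power_log_len_le[OF n] \<theta> C by (intro mult_left_mono) auto
        then show ?thesis by (simp add: mult_ac)
      qed
      finally have "real (card ?Y) \<le>
          exp (4 * \<theta> * C * real n) / (\<theta> powr (\<delta> * real n + 1) * r powr ((c + \<delta>) * real n))"
        using \<theta> r by (simp add: field_simps)
      then have "real (card ?Y) / real ?M \<le>
          exp (4 * \<theta> * C * real n) / (\<theta> powr (\<delta> * real n + 1) * r powr ((c + \<delta>) * real n)) / 2 powr (real n * R)"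
        using M by (intro frac_le) auto
      also have "\<dots> = exp (4 * \<theta> * C * real n - (\<delta> * real n + 1) * ln \<theta>
          - (c + \<delta>) * real n * ln r - real n * R * ln 2)"
        using \<theta>(1) r(1) by (simp add: powr_def exp_diff)
      also have "4 * \<theta> * C * real n - (\<delta> * real n + 1) * ln \<theta>
          - (c + \<delta>) * real n * ln r - real n * R * ln 2 = - ln \<theta> + real n * E"
        unfolding ln_r by (simp add: E_def algebra_simps)
      also have "exp (- ln \<theta> + real n * E) = 1 / \<theta> * exp E ^ n"
        using \<theta> by (simp add: exp_diff exp_of_nat_mult)
      finally show ?thesis .
    qed
    finally show ?thesis by simp
  qed
  have "(\<lambda>n. exp E ^ n) \<longlonglongrightarrow> 0" using E by (intro LIMSEQ_realpow_zero) auto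
  then have "(\<lambda>n. ?cuts n + ?dev n + 1 / \<theta> * exp E ^ n) \<longlonglongrightarrow> 0 + 0 + 1 / \<theta> * 0"
    by (intro tendsto_add tendsto_mult tendsto_const num_cuts_sublinear uncut_windows_concentration \<delta>)
  moreover have "(\<lambda>n. 1 - ?err n) \<longlonglongrightarrow> 1 - 0" by (intro tendsto_diff tendsto_const err)
  ultimately have "1 - 0 \<le> 0 + 0 + 1 / \<theta> * 0"
    using bound by (intro LIMSEQ_le) auto
  then show False by simp
qed

text \<open>All rates in \<open>[0, exp (- \<alpha>))\<close> are achievable and none above
  \<open>exp (- \<alpha>)\<close> is, which determines the supremum whether or not the endpoint is
  attained. Rate 0 makes the set nonempty.\<close>

lemma capacity_eq: "capacity p = exp (- \<alpha>)"
proof (rule antisym)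
  let ?A = "{R. 0 \<le> R \<and> achievable p R}"
  have "0 \<in> ?A" using achievable_below[of 0] by simp
  then show "capacity p \<le> exp (- \<alpha>)"
    unfolding capacity_def by (intro cSup_least) (auto intro: achievable_le)
  have bdd: "bdd_above ?A" by (rule bdd_aboveI[of _ "exp (- \<alpha>)"]) (auto intro: achievable_le)
  show "exp (- \<alpha>) \<le> capacity p"
    unfolding capacity_def
  proof (rule dense_le_bounded[of 0, rotated])
    fix R assume "0 < R" "R < exp (- \<alpha>)"
    then have "R \<in> ?A" using achievable_below[of R] by simp
    then show "R \<le> Sup ?A" using bdd by (rule cSup_upper)
  qed simp
qed

end

theorem theorem1:
  fixes p :: "nat \<Rightarrow> real" and \<alpha> :: real
  assumes "\<And>n. n \<ge> 1 \<Longrightarrow> 0 < p n \<and> p n < 1"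
    and "(\<lambda>n. p n * log 2 (real n)) \<longlonglongrightarrow> \<alpha>"
  shows "capacity p = exp (- \<alpha>)"
proof -
  interpret torn_paper_asymptotics p \<alpha>
    by unfold_locales (fact assms)+
  show ?thesis by (rule capacity_eq)
qed

end
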